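(* Let $n\ge 2$ and $\boldsymbol\mu\in\mathcal M^n$ with $\mu_1>\mu_2\ge\dots\ge\mu_n$, and fix $\alpha\in(1,e/2]$. Run Tri-BBAI with $\epsilon=\frac{1}{\log\log(1/\delta)}$, $L_1=\sqrt{\log(1/\delta)}$, $L_2=\frac{\log(1/\delta)\log\log(1/\delta)}{n}$, $L_3=(\log(1/\delta))^2$, and $\beta(t,\delta)=\log\!\big(\log(1/\delta)\,t^{\alpha}/\delta\big)$. Then there exists $\delta_0\in(0,1)$ such that for all $\delta\in(0,\delta_0)$, the probability that the arm output by the algorithm differs from arm $1$ is at most $\delta$.
   Context: Bandit model. Fix a one-parameter canonical exponential family $\{\nu_\theta\}_{\theta\in\Theta}$ ($\Theta$ an open interval): $\frac{d\nu_\theta}{d\rho}(x)=\exp(x\theta-b(\theta))$ for a reference measure $\rho$ on $\mathbb R$, with $b(\theta)=\log\int e^{x\theta}d\rho(x)$. The mean map $\theta\mapsto b'(\theta)$ is a bijection from $\Theta$ onto an open interval $\mathcal M$, so members of the family are indexed by their mean. For $\mu,\mu'\in\mathcal M$, $d(\mu,\mu')$ denotes the Kullback–Leibler divergence from the member with mean $\mu$ to the member with mean $\mu'$. An instance is $\boldsymbol\mu\in\mathcal M^n$; pulling arm $i$ yields a fresh independent sample from the member with mean $\mu_i$. All logarithms are natural. Characteristic time. For $\boldsymbol\lambda\in\mathcal M^n$ and an index $k$ with $\lambda_k>\lambda_j$ for all $j\ne k$, let $\mathrm{Alt}_k(\boldsymbol\lambda)=\{\boldsymbol\lambda'\in\mathcal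 M^n:\lambda'_j>\lambda'_k\text{ for some }j\neq k\}$, $\mathcal P_n$ the probability simplex in $\mathbb R^n$, and $T^*(\boldsymbol\lambda)^{-1}=\sup_{\mathbf w\in\mathcal P_n}\inf_{\boldsymbol\lambda'\in\mathrm{Alt}_k(\boldsymbol\lambda)}\sum_{i=1}^n w_i\,d(\lambda_i,\lambda'_i)$, with $\mathbf w^*(\boldsymbol\lambda)\in\mathcal P_n$ the (unique) maximizer. Notation during a run. After $t$ total pulls, $N_i(t)$ is the number of pulls of arm $i$, $\hat\mu_i(t)$ the empirical mean of its samples, $i^*(t)\in\arg\max_i\hat\mu_i(t)$ (ties broken by smallest index). For arms $i,j$: $\hat\mu_{ij}(t)=\frac{N_i(t)\hat\mu_i(t)+N_j(t)\hat\mu_j(t)}{N_i(t)+N_j(t)}$; if $\hat\mu_i(t)\ge\hat\mu_j(t)$, $Z_{ij}(t)=N_i(t)\,d(\hat\mu_i(t),\hat\mu_{ij}(t))+N_j(t)\,d(\hat\mu_j(t),\hat\mu_{ij}(t))$, and $Z_j(t)=Z_{i^*(t)j}(t)$. Tri-BBAI algorithm (parameters $\delta,\epsilon,L_1,L_2,L_3,\alpha,\beta$). Stage I (one batch): pull every arm $\lceil L_1\rceil$ times; set $T_i^0=L_1$ for all $i$ and $\mathbf w^*(\mathbf b^0)=(1/n,\dots,1/n)$. Stage II: for $q=1,2,\dots,\lceil\log(1/\delta)\rceil$, with $t$ the current total number of pulls, set $b^q_i=\hat\mu_i(t)+\epsilon$ for $i\ne i^*(t)$ and $b^q_{i^*(t)}=\hat\mu_{i^*(t)}(t)-\epsilon$;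 compute $\mathbf w^*(\mathbf b^q)$ and $T^*(\mathbf b^q)$ with designated index $k=i^*(t)$ (convention: if $\mathbf b^q\notin\mathcal M^n$ or $i^*(t)$ is not the unique maximal coordinate of $\mathbf b^q$, set $\mathbf w^*(\mathbf b^q)$ uniform and $T^*(\mathbf b^q)=+\infty$); let $T_i^q=\min\{\alpha\,w_i^*(\mathbf b^q)T^*(\mathbf b^q)\log(1/\delta),\,L_2\}$; in one batch pull each arm $i$ exactly $\max\{0,\lceil T_i^q\rceil-\lceil\max_{0\le p<q}T_i^p\rceil\}$ times; then if $|w_i^*(\mathbf b^q)-w_i^*(\mathbf b^{q-1})|\le 1/\sqrt n$ for all $i\in[n]$, leave Stage II. Stage III: let $\tau$ be the current total number of pulls; if $\min_{j\ne i^*(\tau)}Z_j(\tau)\ge\beta(\tau,\delta/2)$, stop and output $i^*(\tau)$. Stage IV (one batch, only if Stage III did not stop): pull each arm $i$ an additional $\max\{0,\lceil L_3\rceil-N_i(\tau)\}$ times and output the arm with largest empirical mean. The batch complexity is the number of batches used (Stage I, each executed iteration of Stage II, and Stage IV if executed).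
   Formalization: The divergence d is defined only on M×M, but empirical or pooled means entering Z_ij(t) may lie outside M (e.g. Bernoulli samples all equal to 1); the formal statement sets d to 0 whenever an argument is outside M. *)

theory Defs
  imports "HOL-Probability.Probability"
begin

definition logpart :: "real measure \<Rightarrow> real \<Rightarrow> real" where
  "logpart \<rho> \<theta> = ln (\<integral>x. exp (x * \<theta>) \<partial>\<rho>)"

definition fam :: "real measure \<Rightarrow> real \<Rightarrow> real measure" where
  "fam \<rho> \<theta> = density \<rho> (\<lambda>x. ennreal (exp (x * \<theta> - logpart \<rho> \<theta>)))"

definition fam_mean :: "real measure \<Rightarrow> real \<Rightarrow> real" where
  "fam_mean \<rho> \<theta> = deriv (logpart \<rho>) \<theta>"

definition mean_set :: "real measure \<Rightarrow> real set \<Rightarrow> real set" where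
  "mean_set \<rho> \<Theta> = fam_mean \<rho> ` \<Theta>"

definition nat_param :: "real measure \<Rightarrow> real set \<Rightarrow> real \<Rightarrow> real" where
  "nat_param \<rho> \<Theta> \<mu> = inv_into \<Theta> (fam_mean \<rho>) \<mu>"

definition KL_fam :: "real measure \<Rightarrow> real \<Rightarrow> real \<Rightarrow> real" where
  "KL_fam \<rho> \<theta> \<theta>' =
     (\<integral>x. ln (exp (x * \<theta> - logpart \<rho> \<theta>) / exp (x * \<theta>' - logpart \<rho> \<theta>')) \<partial>(fam \<rho> \<theta>))"

definition fam_div :: "real measure \<Rightarrow> real set \<Rightarrow> real \<Rightarrow> real \<Rightarrow> real" where
  "fam_div \<rho> \<Theta> \<mu> \<mu>' =
     (if \<mu> \<in> mean_set \<rho> \<Theta> \<and> \<mu>' \<in> mean_set \<rho> \<Theta>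
      then KL_fam \<rho> (nat_param \<rho> \<Theta> \<mu>) (nat_param \<rho> \<Theta> \<mu>') else 0)"

definition prob_simplex :: "nat \<Rightarrow> (nat \<Rightarrow> real) set" where
  "prob_simplex n = {w. (\<forall>i<n. 0 \<le> w i) \<and> (\<forall>i\<ge>n. w i = 0) \<and> (\<Sum>i<n. w i) = 1}"

definition Alt :: "real set \<Rightarrow> nat \<Rightarrow> nat \<Rightarrow> (nat \<Rightarrow> real) set" where
  "Alt M n k = {lam'. (\<forall>i<n. lam' i \<in> M) \<and> (\<exists>j<n. j \<noteq> k \<and> lam' k < lam' j)}"

definition objF :: "(real \<Rightarrow> real \<Rightarrow> real) \<Rightarrow> real set \<Rightarrow> nat \<Rightarrow> nat \<Rightarrow> (nat \<Rightarrow> real) \<Rightarrow> (nat \<Rightarrow> real) \<Rightarrow> real" where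
  "objF d M n k lam w = (INF lam' \<in> Alt M n k. \<Sum>i<n. w i * d (lam i) (lam' i))"

definition Tstar_inv :: "(real \<Rightarrow> real \<Rightarrow> real) \<Rightarrow> real set \<Rightarrow> nat \<Rightarrow> nat \<Rightarrow> (nat \<Rightarrow> real) \<Rightarrow> real" where
  "Tstar_inv d M n k lam = (SUP w \<in> prob_simplex n. objF d M n k lam w)"

definition Tstar :: "(real \<Rightarrow> real \<Rightarrow> real) \<Rightarrow> real set \<Rightarrow> nat \<Rightarrow> nat \<Rightarrow> (nat \<Rightarrow> real) \<Rightarrow> real" where
  "Tstar d M n k lam = 1 / Tstar_inv d M n k lam"

definition wstar :: "(real \<Rightarrow> real \<Rightarrow> real) \<Rightarrow> real set \<Rightarrow> nat \<Rightarrow> nat \<Rightarrow> (nat \<Rightarrow> real) \<Rightarrow> (nat \<Rightarrow> real)" where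
  "wstar d M n k lam = (THE w. w \<in> prob_simplex n \<and> objF d M n k lam w = Tstar_inv d M n k lam)"

text \<open>Samples: X (i,k) is the k-th sample (k = 0,1,...) of arm i (arms 0..n-1).
  Pull counts: N :: nat => nat.\<close>

definition emp_mean :: "(nat \<times> nat \<Rightarrow> real) \<Rightarrow> (nat \<Rightarrow> nat) \<Rightarrow> nat \<Rightarrow> real" where
  "emp_mean X N i = (\<Sum>k<N i. X (i, k)) / real (N i)"

definition best_arm :: "nat \<Rightarrow> (nat \<Rightarrow> real) \<Rightarrow> nat" where
  "best_arm n m = (LEAST i. i < n \<and> (\<forall>j<n. m j \<le> m i))"

definition Zstat :: "(real \<Rightarrow> real \<Rightarrow> real) \<Rightarrow> (nat \<times> nat \<Rightarrow> real) \<Rightarrow> (nat \<Rightarrow> nat) \<Rightarrow> nat \<Rightarrow> nat \<Rightarrow> real" where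
  "Zstat d X N i j =
     (let mi = emp_mean X N i; mj = emp_mean X N j;
          mij = (real (N i) * mi + real (N j) * mj) / real (N i + N j)
      in real (N i) * d mi mij + real (N j) * d mj mij)"

type_synonym state = "(nat \<Rightarrow> nat) \<times> (nat \<Rightarrow> real) \<times> (nat \<Rightarrow> real) \<times> bool"
  \<comment> \<open>(pull counts N, previous weights w*(b^{q-1}), max_{p<q} T^p, exited Stage II)\<close>

definition uniform_w :: "nat \<Rightarrow> nat \<Rightarrow> real" where
  "uniform_w n = (\<lambda>i. if i < n then 1 / real n else 0)"

definition stage2_step ::
  "(real \<Rightarrow> real \<Rightarrow> real) \<Rightarrow> real set \<Rightarrow> nat \<Rightarrow> real \<Rightarrow> real \<Rightarrow> real \<Rightarrow> real
   \<Rightarrow> (nat \<times> nat \<Rightarrow> real) \<Rightarrow> state \<Rightarrow> state" where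
  "stage2_step d M n \<delta> \<epsilon> L2 \<alpha> X s =
     (case s of (N, wprev, Tmax, ex) \<Rightarrow>
       (let m = emp_mean X N; k = best_arm n m;
            b = (\<lambda>i. if i = k then m i - \<epsilon> else m i + \<epsilon>);
            valid = ((\<forall>i<n. b i \<in> M) \<and> (\<forall>j<n. j \<noteq> k \<longrightarrow> b j < b k));
            w = (if valid then wstar d M n k b else uniform_w n);
            T = (\<lambda>i. if valid then min (\<alpha> * w i * Tstar d M n k b * ln (1 / \<delta>)) L2 else L2);
            N' = (\<lambda>i. N i + nat (\<lceil>T i\<rceil> - \<lceil>Tmax i\<rceil>));
            Tmax' = (\<lambda>i. max (Tmax i) (T i));
            ex' = (\<forall>i<n. \<bar>w i - wprev i\<bar> \<le> 1 / sqrt (real n))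
        in (N', w, Tmax', ex')))"

definition stage2_guarded ::
  "(real \<Rightarrow> real \<Rightarrow> real) \<Rightarrow> real set \<Rightarrow> nat \<Rightarrow> real \<Rightarrow> real \<Rightarrow> real \<Rightarrow> real
   \<Rightarrow> (nat \<times> nat \<Rightarrow> real) \<Rightarrow> state \<Rightarrow> state" where
  "stage2_guarded d M n \<delta> \<epsilon> L2 \<alpha> X s =
     (if snd (snd (snd s)) then s else stage2_step d M n \<delta> \<epsilon> L2 \<alpha> X s)"

definition triBBAI ::
  "(real \<Rightarrow> real \<Rightarrow> real) \<Rightarrow> real set \<Rightarrow> nat \<Rightarrow> real \<Rightarrow> real \<Rightarrow> real \<Rightarrow> real \<Rightarrow> real \<Rightarrow> real
   \<Rightarrow> (real \<Rightarrow> real \<Rightarrow> real) \<Rightarrow> (nat \<times> nat \<Rightarrow> real) \<Rightarrow> nat" where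
  "triBBAI d M n \<delta> \<epsilon> L1 L2 L3 \<alpha> \<beta> X =
     (let Q = nat \<lceil>ln (1 / \<delta>)\<rceil>;
          init = ((\<lambda>i. nat \<lceil>L1\<rceil>), uniform_w n, (\<lambda>i. L1), False);
          N = fst ((stage2_guarded d M n \<delta> \<epsilon> L2 \<alpha> X ^^ Q) init);
          \<tau> = (\<Sum>i<n. N i);
          k = best_arm n (emp_mean X N)
      in if (\<forall>j<n. j \<noteq> k \<longrightarrow> \<beta> (real \<tau>) (\<delta> / 2) \<le> Zstat d X N k j) then k
         else best_arm n (emp_mean X (\<lambda>i. max (N i) (nat \<lceil>L3\<rceil>))))"

end

theory Submission
  imports Defs "HOL-Real_Asymp.Real_Asymp"
begin

text \<open>
  Write \<open>L = log (1/\<delta>)\<close> and let \<open>B\<close> be the log-partition function. Every arm has between \<open>\<surd>L\<close> and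
  \<open>L\<^sup>2\<close> pulls when Stage III is reached, and the threshold is at least \<open>L\<close>. If Stage III stops with a
  suboptimal arm \<open>k\<close>, then the empirical means of arms \<open>k\<close> and \<open>0\<close> are in the wrong order, and the
  log-likelihood ratio of the two samples against the \<^emph>\<open>true\<close> parameters exceeds \<open>Z\<close> by at least
  \<open>c \<surd>L\<close>, where \<open>c > 0\<close> is the gap in Jensen's inequality for \<open>B\<close> at the two parameters. For fixed pull
  counts, Chernoff's bound for each arm and independence bound the probability of this by
  \<open>O(L) exp (- L - c \<surd>L)\<close>. The factor \<open>exp (- c \<surd>L)\<close> beats the polynomially many choices of
  pull counts, so a plain union bound gives at most \<open>\<delta>/2\<close>. In Stage IV all arms have \<open>\<lceil>L\<^sup>2\<rceil>\<close> samples, and a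
  wrong order has probability at most \<open>exp (- c L\<^sup>2)\<close>. Neither bound depends on which weights Stage II computes.
\<close>

section \<open>One-parameter exponential families\<close>

lemma exp_abs_le: "exp \<bar>y :: real\<bar> \<le> exp y + exp (- y)"
  by (cases "y \<ge> 0") auto

text \<open>Dominates the second-order Taylor remainder of \<open>exp (x * t)\<close> in the
  parameter by exponentials at two nearby parameters. The factor \<open>x\<^sup>2\<close> is
  absorbed through y^2 / 2 <= exp y, at the price of a second factor
  \<open>exp (e * \<bar>x\<bar>)\<close>.\<close>

lemma sq_mult_exp_le:
  fixes x t e :: real
  assumes "0 < e"
  shows "x\<^sup>2 * exp (e * \<bar>x\<bar>) * exp (x * t) \<le> 2 / e\<^sup>2 * (exp (x * (t + 2 * e)) + exp (x * (t - 2 * e)))"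
proof -
  have "(e * \<bar>x\<bar>)\<^sup>2 / 2 \<le> exp (e * \<bar>x\<bar>)"
    using exp_lower_Taylor_quadratic[of "e * \<bar>x\<bar>"] assms
    by (smt (verit) mult_nonneg_nonneg abs_ge_zero)
  hence "x\<^sup>2 \<le> 2 / e\<^sup>2 * exp (e * \<bar>x\<bar>)"
    using assms by (simp add: field_simps power_mult_distrib)
  hence "x\<^sup>2 * exp (e * \<bar>x\<bar>) * exp (x * t) \<le> 2 / e\<^sup>2 * exp (e * \<bar>x\<bar>) * exp (e * \<bar>x\<bar>) * exp (x * t)"
    by (intro mult_right_mono) auto
  also have "\<dots> = 2 / e\<^sup>2 * (exp \<bar>2 * e * x\<bar> * exp (x * t))"
    using assms by (simp add: exp_add[symmetric] abs_mult algebra_simps)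
  also have "\<dots> \<le> 2 / e\<^sup>2 * ((exp (2 * e * x) + exp (- (2 * e * x))) * exp (x * t))"
    by (intro mult_left_mono mult_right_mono exp_abs_le) auto
  also have "\<dots> = 2 / e\<^sup>2 * (exp (x * (t + 2 * e)) + exp (x * (t - 2 * e)))"
    by (simp add: exp_add[symmetric] algebra_simps)
  finally show ?thesis .
qed

text \<open>Injectivity of the mean map is the non-degeneracy condition: for nonempty \<Theta> it
  rules out the zero measure and point masses as \<open>\<rho>\<close>, and it makes Jensen's
  inequality for the log-partition function strict.\<close>

locale exp_family =
  fixes \<rho> :: "real measure" and \<Theta> :: "real set"
  assumes sets_rho [measurable_cong]: "sets \<rho> = sets borel"
    and open_params: "open \<Theta>" and interval_params: "is_interval \<Theta>"
    and integrable_exp: "\<theta> \<in> \<Theta> \<Longrightarrow> integrable \<rho> (\<lambda>x. exp (x * \<theta>))"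
    and inj_mean: "inj_on (fam_mean \<rho>) \<Theta>"
begin

abbreviation "B \<equiv> logpart \<rho>"

lemma space_rho [simp]: "space \<rho> = UNIV"
  using sets_eq_imp_space_eq[OF sets_rho] by simp

text \<open>A vanishing integral would make \<open>\<rho>\<close> null, hence the mean map constant
  on \<Theta>, which contains a whole neighbourhood of \<open>\<theta>\<close>.\<close>

lemma partition_pos:
  assumes "\<theta> \<in> \<Theta>"
  shows "0 < (\<integral>x. exp (x * \<theta>) \<partial>\<rho>)"
proof (rule ccontr)
  assume "\<not> ?thesis"
  moreover have "0 \<le> (\<integral>x. exp (x * \<theta>) \<partial>\<rho>)" by simp
  ultimately have "(\<integral>x. exp (x * \<theta>) \<partial>\<rho>) = 0" by linarith
  hence "AE x in \<rho>. exp (x * \<theta>) = 0"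
    using integral_nonneg_eq_0_iff_AE[OF integrable_exp[OF assms]] by simp
  hence null: "AE x in \<rho>. False" by eventually_elim simp
  have "(\<integral>x. exp (x * t) \<partial>\<rho>) = 0" for t
  proof -
    have "(\<integral>x. exp (x * t) \<partial>\<rho>) = (\<integral>x. 0 \<partial>\<rho>)"
      by (intro integral_cong_AE) (use null in auto)
    thus ?thesis by simp
  qed
  \<comment> \<open>This uses the default value \<open>ln 0 = 0\<close>.\<close>
  hence const: "logpart \<rho> = (\<lambda>_. 0)" by (simp add: logpart_def fun_eq_iff)
  obtain e where e: "0 < e" "ball \<theta> e \<subseteq> \<Theta>"
    using open_params assms by (meson openE)
  hence "\<theta> + e / 2 \<in> \<Theta>" by (auto simp: dist_real_def intro!: subsetD[OF e(2)])
  moreover have "fam_mean \<rho> (\<theta> + e / 2) = fam_mean \<rho> \<theta>"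
    by (simp add: fam_mean_def const)
  ultimately have "\<theta> + e / 2 = \<theta>" using inj_onD[OF inj_mean] assms by blast
  thus False using e by simp
qed

lemma exp_logpart: "\<theta> \<in> \<Theta> \<Longrightarrow> exp (B \<theta>) = (\<integral>x. exp (x * \<theta>) \<partial>\<rho>)"
  using partition_pos[of \<theta>] by (simp add: logpart_def)

text \<open>Differentiation under the integral sign by a quadratic error bound: for small
  \<open>h\<close> the first-order remainder is at most \<open>h\<^sup>2 * C\<close> with a finite
  integral \<open>C\<close>, so the difference quotient converges.\<close>

lemma DERIV_partition:
  assumes "\<theta> \<in> \<Theta>"
  shows "integrable \<rho> (\<lambda>x. x * exp (x * \<theta>))"
    and "((\<lambda>t. \<integral>x. exp (x * t) \<partial>\<rho>) has_real_derivative (\<integral>x. x * exp (x * \<theta>) \<partial>\<rho>)) (at \<theta>)"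
proof -
  obtain r where r: "0 < r" "ball \<theta> r \<subseteq> \<Theta>"
    using open_params assms by (meson openE)
  \<comment> \<open>A third of the radius keeps the dominating parameters
    \<open>\<theta> + 2 * e\<close> and \<open>\<theta> - 2 * e\<close> inside \<Theta>.\<close>
  define e where "e = r / 3"
  have e: "0 < e" using r by (simp add: e_def)
  have mem: "\<theta> + h \<in> \<Theta>" if "\<bar>h\<bar> < r" for h
    using that r by (auto simp: dist_real_def)
  have "integrable \<rho> (\<lambda>x. 2 / e\<^sup>2 * (exp (x * (\<theta> + 2 * e)) + exp (x * (\<theta> - 2 * e))))"
    using integrable_exp[OF mem[of "2 * e"]] integrable_exp[OF mem[of "- (2 * e)"]] r
    by (auto simp: e_def)
  hence int2: "integrable \<rho> (\<lambda>x. x\<^sup>2 * exp (e * \<bar>x\<bar>) * exp (x * \<theta>))"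
    by (rule Bochner_Integration.integrable_bound)
      (use sq_mult_exp_le[OF e] in \<open>auto intro!: order_trans[OF _ abs_ge_self]\<close>)
  show int1: "integrable \<rho> (\<lambda>x. x * exp (x * \<theta>))"
  proof (rule Bochner_Integration.integrable_bound)
    show "integrable \<rho> (\<lambda>x. exp (x * \<theta>) + x\<^sup>2 * exp (e * \<bar>x\<bar>) * exp (x * \<theta>))"
      using integrable_exp[OF assms] int2 by auto
    show "AE x in \<rho>. norm (x * exp (x * \<theta>)) \<le> norm (exp (x * \<theta>) + x\<^sup>2 * exp (e * \<bar>x\<bar>) * exp (x * \<theta>))"
    proof (intro AE_I2)
      fix x :: real
      have "\<bar>x\<bar> \<le> 1 + x\<^sup>2"
        using zero_le_power2[of "\<bar>x\<bar> - 1"] by (simp add: power2_diff)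
      also have "\<dots> \<le> 1 + x\<^sup>2 * exp (e * \<bar>x\<bar>)"
        using mult_left_mono[of 1 "exp (e * \<bar>x\<bar>)" "x\<^sup>2"] e by simp
      finally have "\<bar>x\<bar> * exp (x * \<theta>) \<le> (1 + x\<^sup>2 * exp (e * \<bar>x\<bar>)) * exp (x * \<theta>)"
        by (intro mult_right_mono) auto
      thus "norm (x * exp (x * \<theta>)) \<le> norm (exp (x * \<theta>) + x\<^sup>2 * exp (e * \<bar>x\<bar>) * exp (x * \<theta>))"
        by (simp add: abs_mult algebra_simps)
    qed
  qed simp
  define Z where "Z = (\<lambda>t. \<integral>x. exp (x * t) \<partial>\<rho>)"
  define D where "D = (\<integral>x. x * exp (x * \<theta>) \<partial>\<rho>)"
  define C where "C = (\<integral>x. x\<^sup>2 * exp (e * \<bar>x\<bar>) * exp (x * \<theta>) \<partial>\<rho>)"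
  have quad: "\<bar>Z (\<theta> + h) - Z \<theta> - h * D\<bar> \<le> h\<^sup>2 * C" if h: "\<bar>h\<bar> \<le> e" for h
  proof -
    have inth: "integrable \<rho> (\<lambda>x. exp (x * (\<theta> + h)))"
      by (rule integrable_exp[OF mem]) (use h r in \<open>auto simp: e_def\<close>)
    have "Z (\<theta> + h) - Z \<theta> - h * D =
        (\<integral>x. exp (x * (\<theta> + h)) - exp (x * \<theta>) - h * (x * exp (x * \<theta>)) \<partial>\<rho>)"
      unfolding Z_def D_def using inth integrable_exp[OF assms] int1 by simp
    also have "\<bar>\<dots>\<bar> \<le> (\<integral>x. h\<^sup>2 * (x\<^sup>2 * exp (e * \<bar>x\<bar>) * exp (x * \<theta>)) \<partial>\<rho>)"
    proof (rule Bochner_Integration.integral_abs_bound_integral)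
      fix x :: real
      have "\<bar>exp (x * h) - 1 - x * h\<bar> \<le> exp \<bar>x * h\<bar> * (x * h)\<^sup>2"
        using Taylor_exp_field[of "x * h" 1] by (simp add: algebra_simps power2_eq_square)
      also have "\<dots> \<le> exp (e * \<bar>x\<bar>) * (x * h)\<^sup>2"
        using h by (intro mult_right_mono) (auto simp: abs_mult mult.commute[of e] intro!: mult_left_mono)
      finally have "\<bar>exp (x * h) - 1 - x * h\<bar> * exp (x * \<theta>) \<le> exp (e * \<bar>x\<bar>) * (x * h)\<^sup>2 * exp (x * \<theta>)"
        by (intro mult_right_mono) auto
      moreover have "exp (x * (\<theta> + h)) - exp (x * \<theta>) - h * (x * exp (x * \<theta>)) =
          (exp (x * h) - 1 - x * h) * exp (x * \<theta>)"
        by (simp add: distrib_left exp_add left_diff_distrib right_diff_distrib mult_ac)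
      ultimately show "\<bar>exp (x * (\<theta> + h)) - exp (x * \<theta>) - h * (x * exp (x * \<theta>))\<bar>
          \<le> h\<^sup>2 * (x\<^sup>2 * exp (e * \<bar>x\<bar>) * exp (x * \<theta>))"
        by (simp add: abs_mult power_mult_distrib mult_ac)
    qed (use inth integrable_exp[OF assms] int1 int2 in auto)
    also have "\<dots> = h\<^sup>2 * C" by (simp add: C_def)
    finally show ?thesis .
  qed
  have "((\<lambda>h. (Z (\<theta> + h) - Z \<theta>) / h - D) \<longlongrightarrow> 0) (at 0)"
  proof (rule Lim_null_comparison)
    have "\<forall>\<^sub>F h in at 0. \<bar>h :: real\<bar> < e \<and> h \<noteq> 0"
      using e by (auto simp: eventually_at intro!: exI[of _ e])
    thus "\<forall>\<^sub>F h in at 0. norm ((Z (\<theta> + h) - Z \<theta>) / h - D) \<le> \<bar>h\<bar> * C"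
    proof eventually_elim
      case (elim h)
      hence "(Z (\<theta> + h) - Z \<theta>) / h - D = (Z (\<theta> + h) - Z \<theta> - h * D) / h"
        by (simp add: diff_divide_distrib)
      hence "norm ((Z (\<theta> + h) - Z \<theta>) / h - D) = \<bar>Z (\<theta> + h) - Z \<theta> - h * D\<bar> / \<bar>h\<bar>"
        by simp
      also have "\<dots> \<le> h\<^sup>2 * C / \<bar>h\<bar>"
        using quad[of h] elim by (intro divide_right_mono) auto
      also have "\<dots> = \<bar>h\<bar> * C"
        using elim by (cases "h > 0") (auto simp: power2_eq_square)
      finally show ?case .
    qed
    show "((\<lambda>h. \<bar>h\<bar> * C) \<longlongrightarrow> 0) (at 0)"
      by (auto intro!: tendsto_eq_intros)
  qed
  hence "((\<lambda>h. (Z (\<theta> + h) - Z \<theta>) / h) \<longlongrightarrow> D) (at 0)"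
    by (rule Lim_null[THEN iffD2])
  thus "((\<lambda>t. \<integral>x. exp (x * t) \<partial>\<rho>) has_real_derivative D) (at \<theta>)"
    by (simp add: DERIV_def Z_def)
qed

lemma fam_density: "\<theta> \<in> \<Theta> \<Longrightarrow> exp (x * \<theta> - B \<theta>) = exp (x * \<theta>) / (\<integral>x. exp (x * \<theta>) \<partial>\<rho>)"
  by (simp add: exp_diff exp_logpart)

section \<open>Members of the family: normalisation and moments\<close>

lemma sets_fam [simp, measurable_cong]: "sets (fam \<rho> \<theta>) = sets borel"
  by (simp add: fam_def sets_rho)

lemma space_fam [simp]: "space (fam \<rho> \<theta>) = UNIV"
  by (simp add: fam_def)

lemma prob_space_fam:
  assumes "\<theta> \<in> \<Theta>"
  shows "prob_space (fam \<rho> \<theta>)"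
proof
  have "emeasure (fam \<rho> \<theta>) (space (fam \<rho> \<theta>)) = (\<integral>\<^sup>+x. ennreal (exp (x * \<theta> - B \<theta>)) \<partial>\<rho>)"
    by (simp add: fam_def emeasure_density)
  also have "\<dots> = ennreal (\<integral>x. exp (x * \<theta> - B \<theta>) \<partial>\<rho>)"
    by (rule nn_integral_eq_integral) (use integrable_exp[OF assms] in \<open>simp_all add: fam_density[OF assms]\<close>)
  also have "(\<integral>x. exp (x * \<theta> - B \<theta>) \<partial>\<rho>) = 1"
    using partition_pos[OF assms] by (simp add: fam_density[OF assms])
  finally show "emeasure (fam \<rho> \<theta>) (space (fam \<rho> \<theta>)) = 1" by simp
qed

lemma DERIV_logpart:
  assumes "\<theta> \<in> \<Theta>"
  shows "(B has_real_derivative fam_mean \<rho> \<theta>) (at \<theta>)"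
    and "fam_mean \<rho> \<theta> = (\<integral>x. x * exp (x * \<theta>) \<partial>\<rho>) / (\<integral>x. exp (x * \<theta>) \<partial>\<rho>)"
proof -
  have D: "(B has_real_derivative (\<integral>x. x * exp (x * \<theta>) \<partial>\<rho>) / (\<integral>x. exp (x * \<theta>) \<partial>\<rho>)) (at \<theta>)"
    unfolding logpart_def [abs_def]
    using DERIV_chain2[where f=ln, OF DERIV_ln_divide[OF partition_pos[OF assms]] DERIV_partition(2)[OF assms]]
    by simp
  thus "fam_mean \<rho> \<theta> = (\<integral>x. x * exp (x * \<theta>) \<partial>\<rho>) / (\<integral>x. exp (x * \<theta>) \<partial>\<rho>)"
    unfolding fam_mean_def by (rule DERIV_imp_deriv)
  with D show "(B has_real_derivative fam_mean \<rho> \<theta>) (at \<theta>)" by simp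
qed

lemma fam_first_moment:
  assumes "\<theta> \<in> \<Theta>"
  shows "integrable (fam \<rho> \<theta>) (\<lambda>x. x)" and "(\<integral>x. x \<partial>fam \<rho> \<theta>) = fam_mean \<rho> \<theta>"
proof -
  have *: "exp (x * \<theta> - B \<theta>) *\<^sub>R x = x * exp (x * \<theta>) / (\<integral>x. exp (x * \<theta>) \<partial>\<rho>)" for x
    by (simp add: fam_density[OF assms])
  show "integrable (fam \<rho> \<theta>) (\<lambda>x. x)"
    unfolding fam_def using DERIV_partition(1)[OF assms]
    by (subst integrable_density) (auto simp only: * intro!: integrable_divide_zero, auto)
  show "(\<integral>x. x \<partial>fam \<rho> \<theta>) = fam_mean \<rho> \<theta>"
    unfolding fam_def by (subst integral_density) (simp_all only: * DERIV_logpart(2)[OF assms], auto)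
qed

lemma fam_mgf:
  assumes "\<theta> \<in> \<Theta>" "\<theta> + h \<in> \<Theta>"
  shows "integrable (fam \<rho> \<theta>) (\<lambda>x. exp (h * x))"
    and "(\<integral>x. exp (h * x) \<partial>fam \<rho> \<theta>) = exp (B (\<theta> + h) - B \<theta>)"
proof -
  have *: "exp (x * \<theta> - B \<theta>) * exp (h * x) = exp (x * (\<theta> + h)) * exp (- B \<theta>)" for x
    by (simp add: exp_add[symmetric] algebra_simps)
  show "integrable (fam \<rho> \<theta>) (\<lambda>x. exp (h * x))"
    using integrable_exp[OF assms(2)] by (simp add: fam_def integrable_density *)
  show "(\<integral>x. exp (h * x) \<partial>fam \<rho> \<theta>) = exp (B (\<theta> + h) - B \<theta>)"
    using exp_logpart[OF assms(2)]
    by (simp add: fam_def integral_density *) (simp add: exp_diff exp_minus divide_inverse)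
qed

section \<open>Divergence, convexity and the mean parametrisation\<close>

lemma KL_fam_eq:
  assumes "\<theta> \<in> \<Theta>"
  shows "KL_fam \<rho> \<theta> \<theta>' = (\<theta> - \<theta>') * fam_mean \<rho> \<theta> - B \<theta> + B \<theta>'"
proof -
  interpret prob_space "fam \<rho> \<theta>" by (rule prob_space_fam[OF assms])
  have "KL_fam \<rho> \<theta> \<theta>' = (\<integral>x. (\<theta> - \<theta>') * x + (B \<theta>' - B \<theta>) \<partial>fam \<rho> \<theta>)"
    unfolding KL_fam_def
    by (intro Bochner_Integration.integral_cong) (auto simp: exp_diff[symmetric] algebra_simps)
  also have "\<dots> = (\<theta> - \<theta>') * (\<integral>x. x \<partial>fam \<rho> \<theta>) + (B \<theta>' - B \<theta>)"
    using fam_first_moment[OF assms] by (simp add: prob_space[simplified])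
  finally show ?thesis by (simp add: fam_first_moment[OF assms])
qed

text \<open>Integrate 1 + y <= exp y against the member at \<open>\<theta>\<close>, with y the
  log-density ratio of \<open>\<theta>'\<close> to \<open>\<theta>\<close>. This is nonnegativity of
  the divergence and gives convexity without second derivatives.\<close>

lemma logpart_above_tangent:
  assumes "\<theta> \<in> \<Theta>" "\<theta>' \<in> \<Theta>"
  shows "B \<theta> + fam_mean \<rho> \<theta> * (\<theta>' - \<theta>) \<le> B \<theta>'"
proof -
  interpret prob_space "fam \<rho> \<theta>" by (rule prob_space_fam[OF assms(1)])
  define c where "c = B \<theta>' - B \<theta>"
  have mgf: "integrable (fam \<rho> \<theta>) (\<lambda>x. exp ((\<theta>' - \<theta>) * x))"
      "(\<integral>x. exp ((\<theta>' - \<theta>) * x) \<partial>fam \<rho> \<theta>) = exp c"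
    using fam_mgf[of \<theta> "\<theta>' - \<theta>"] assms by (simp_all add: c_def)
  have "(\<integral>x. 1 + ((\<theta>' - \<theta>) * x - c) \<partial>fam \<rho> \<theta>) \<le> (\<integral>x. exp ((\<theta>' - \<theta>) * x) * exp (- c) \<partial>fam \<rho> \<theta>)"
  proof (rule integral_mono)
    show "1 + ((\<theta>' - \<theta>) * x - c) \<le> exp ((\<theta>' - \<theta>) * x) * exp (- c)" for x
      using exp_ge_add_one_self[of "(\<theta>' - \<theta>) * x - c"] by (simp add: exp_add[symmetric])
  qed (use mgf fam_first_moment[OF assms(1)] in auto)
  also have "\<dots> = exp c * exp (- c)" by (simp add: mgf)
  also have "\<dots> = 1" by (simp flip: exp_add)
  also have "(\<integral>x. 1 + ((\<theta>' - \<theta>) * x - c) \<partial>fam \<rho> \<theta>) = 1 + ((\<theta>' - \<theta>) * fam_mean \<rho> \<theta> - c)"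
    using fam_first_moment[OF assms(1)] by (simp add: prob_space[simplified])
  finally show ?thesis by (simp add: c_def algebra_simps)
qed

lemma nat_param_mem: "m \<in> mean_set \<rho> \<Theta> \<Longrightarrow> nat_param \<rho> \<Theta> m \<in> \<Theta>"
  and fam_mean_nat_param: "m \<in> mean_set \<rho> \<Theta> \<Longrightarrow> fam_mean \<rho> (nat_param \<rho> \<Theta> m) = m"
  unfolding mean_set_def nat_param_def by (auto intro: inv_into_into f_inv_into_f)

lemma fam_div_eq:
  assumes "m \<in> mean_set \<rho> \<Theta>" "m' \<in> mean_set \<rho> \<Theta>"
  shows "fam_div \<rho> \<Theta> m m' = (nat_param \<rho> \<Theta> m - nat_param \<rho> \<Theta> m') * m
           - B (nat_param \<rho> \<Theta> m) + B (nat_param \<rho> \<Theta> m')"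
  using assms by (simp add: fam_div_def KL_fam_eq nat_param_mem fam_mean_nat_param)

text \<open>Adding the tangent inequalities at both parameters shows that means and parameters are
  ordered alike; equal parameters would have equal means.\<close>

lemma nat_param_mono:
  assumes "m \<in> mean_set \<rho> \<Theta>" "m' \<in> mean_set \<rho> \<Theta>" "m < m'"
  shows "nat_param \<rho> \<Theta> m < nat_param \<rho> \<Theta> m'"
proof -
  let ?s = "nat_param \<rho> \<Theta> m" and ?t = "nat_param \<rho> \<Theta> m'"
  have "B ?s + m * (?t - ?s) \<le> B ?t" "B ?t + m' * (?s - ?t) \<le> B ?s"
    using logpart_above_tangent[of ?s ?t] logpart_above_tangent[of ?t ?s] assms
    by (simp_all add: nat_param_mem fam_mean_nat_param)
  hence "0 \<le> (m' - m) * (?t - ?s)" by (simp add: algebra_simps)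
  hence "?s \<le> ?t" using assms by (simp add: zero_le_mult_iff)
  moreover have "?s \<noteq> ?t" using assms by (metis fam_mean_nat_param less_irrefl)
  ultimately show ?thesis by simp
qed

lemma midpoint_mem: "s \<in> \<Theta> \<Longrightarrow> t \<in> \<Theta> \<Longrightarrow> (s + t) / 2 \<in> \<Theta>"
proof -
  assume st: "s \<in> \<Theta>" "t \<in> \<Theta>"
  show ?thesis
  proof (cases "s \<le> t")
    case True
    thus ?thesis by (intro mem_is_interval_1_I[OF interval_params st]) auto
  next
    case False
    thus ?thesis by (intro mem_is_interval_1_I[OF interval_params st(2,1)]) auto
  qed
qed

text \<open>For parameters in \<Theta> this is twice the Bhattacharyya distance of the two members,
  and also the least value of \<open>KL_fam \<rho> r s + KL_fam \<rho> r t\<close> over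
  \<open>r\<close>, attained at the midpoint. The first reading governs Stage IV, the second Stage
  III.\<close>

definition jensen_gap :: "real \<Rightarrow> real \<Rightarrow> real" where
  "jensen_gap s t = B s + B t - 2 * B ((s + t) / 2)"

text \<open>Let \<open>f\<close> be the excess of \<open>B\<close> over its tangent at the midpoint
  \<open>r\<close>. If it vanished at \<open>s\<close>, then \<open>s\<close> would be an interior
  minimum of \<open>f\<close>, so \<open>s\<close> and \<open>r\<close> would have the same
  mean.\<close>

lemma jensen_gap_pos:
  assumes st: "s \<in> \<Theta>" "t \<in> \<Theta>" "s \<noteq> t"
  shows "0 < jensen_gap s t"
proof -
  define r where "r = (s + t) / 2"
  have r: "r \<in> \<Theta>" using midpoint_mem st by (simp add: r_def)
  define f where "f = (\<lambda>x. B x - (B r + fam_mean \<rho> r * (x - r)))"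
  have nonneg: "0 \<le> f x" if "x \<in> \<Theta>" for x
    using logpart_above_tangent[OF r that] by (simp add: f_def)
  have "f s \<noteq> 0"
  proof
    assume fs: "f s = 0"
    obtain e where e: "0 < e" "ball s e \<subseteq> \<Theta>"
      using open_params st by (meson openE)
    have "(f has_real_derivative fam_mean \<rho> s - fam_mean \<rho> r) (at s)"
      unfolding f_def by (auto intro!: derivative_eq_intros DERIV_logpart st)
    moreover have "\<forall>y. \<bar>s - y\<bar> < e \<longrightarrow> f s \<le> f y"
      using nonneg e fs by (auto simp: subset_iff dist_real_def)
    ultimately have "fam_mean \<rho> s - fam_mean \<rho> r = 0"
      using DERIV_local_min e(1) by blast
    hence "s = r" using inj_onD[OF inj_mean] st r by simp
    thus False using st by (simp add: r_def field_simps)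
  qed
  hence "0 < f s + f t" using nonneg[of s] nonneg[of t] st by linarith
  \<comment> \<open>The linear terms cancel because \<open>r\<close> is the midpoint.\<close>
  also have "\<dots> = jensen_gap s t"
    unfolding f_def jensen_gap_def r_def by (simp add: field_simps)
  finally show ?thesis .
qed

end

section \<open>Deviation probabilities for fixed pull counts\<close>

text \<open>An uncountable union of half-lines is reduced to an increasing sequence of half-lines
  \<open>{r k..}\<close>, each contained in some \<open>{t..}\<close>; continuity from below carries
  the bound to the limit.\<close>

lemma upward_closure_measure_le:
  fixes T :: "real set"
  assumes "finite_measure M" and sets: "sets M = sets borel"
    and le: "\<And>t. t \<in> T \<Longrightarrow> measure M {t..} \<le> p" and p: "0 \<le> p"
  shows "{y. \<exists>t\<in>T. t \<le> y} \<in> sets borel" and "measure M {y. \<exists>t\<in>T. t \<le> y} \<le> p"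
proof -
  interpret finite_measure M by fact
  let ?U = "{y. \<exists>t\<in>T. t \<le> y}"
  have "?U \<in> sets borel \<and> measure M ?U \<le> p"
  proof (cases "T = {}")
    case False
    \<comment> \<open>The closure is a closed half-line if the infimum of \<open>T\<close> is
      attained, an open one if it is not, and the whole line if \<open>T\<close> is unbounded
      below.\<close>
    obtain r :: "nat \<Rightarrow> real" where r: "decseq r" "\<And>k. r k \<in> ?U" "?U = (\<Union>k. {r k..})"
    proof (cases "bdd_below T")
      case bdd: True
      show ?thesis
      proof (cases "Inf T \<in> T")
        case True
        show ?thesis
          by (rule that[of "\<lambda>_. Inf T"])
            (use True bdd in \<open>auto simp: decseq_def intro: cInf_lower order_trans\<close>)
      next
        case False
        have gt: "Inf T < t" if "t \<in> T" for t
          using cInf_lower[OF that bdd] False that by (metis order_le_less)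
        have mem: "y \<in> ?U" if "Inf T < y" for y
          using cInf_lessD[OF \<open>T \<noteq> {}\<close> that] by (auto intro: less_imp_le)
        show ?thesis
        proof (rule that[of "\<lambda>k. Inf T + 1 / real (Suc k)"])
          show "decseq (\<lambda>k. Inf T + 1 / real (Suc k))"
            by (auto simp: decseq_def field_simps)
          show up: "Inf T + 1 / real (Suc k) \<in> ?U" for k
            by (rule mem) simp
          show "?U = (\<Union>k. {Inf T + 1 / real (Suc k)..})"
          proof safe
            fix y t assume "t \<in> T" "t \<le> y"
            hence "0 < y - Inf T" using gt[of t] by simp
            then obtain k where "1 / real (Suc k) < y - Inf T" by (rule nat_approx_posE)
            thus "y \<in> (\<Union>k. {Inf T + 1 / real (Suc k)..})" by (intro UN_I[of k]) auto
          next
            fix y k assume "Inf T + 1 / real (Suc k) \<le> y"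
            thus "\<exists>t\<in>T. t \<le> y" using up[of k] by (auto intro: order_trans)
          qed
        qed
      qed
    next
      case False
      have all: "\<exists>t\<in>T. t \<le> y" for y
        using False unfolding bdd_below_def by (meson linear)
      show ?thesis
      proof (rule that[of "\<lambda>k. - real k"])
        show "?U = (\<Union>k. {- real k..})"
        proof -
          have "\<exists>k. - real k \<le> y" for y :: real
            using real_arch_simple[of "- y"] by (auto simp: minus_le_iff)
          thus ?thesis using all by auto
        qed
      qed (use all in \<open>auto simp: decseq_def\<close>)
    qed
    have "(\<lambda>k. measure M {r k..}) \<longlonglongrightarrow> measure M (\<Union>k. {r k..})"
      by (rule finite_Lim_measure_incseq)
        (use r(1) in \<open>auto simp: sets incseq_def decseq_def intro: order_trans\<close>)
    moreover have "measure M {r k..} \<le> p" for k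
    proof -
      obtain t where t: "t \<in> T" "t \<le> r k" using r(2)[of k] by auto
      have "measure M {r k..} \<le> measure M {t..}"
        by (rule finite_measure_mono) (use t in \<open>auto simp: sets\<close>)
      thus ?thesis using le[OF t(1)] by simp
    qed
    ultimately have "measure M (\<Union>k. {r k..}) \<le> p" by (auto intro: LIMSEQ_le_const2)
    moreover have "(\<Union>k. {r k..}) \<in> sets borel" by auto
    ultimately show ?thesis by (simp only: r(3))
  qed (use p in simp)
  thus "?U \<in> sets borel" "measure M ?U \<le> p" by auto
qed

lemma indep_vars_PiM_components:
  assumes prob: "\<And>i. i \<in> I \<Longrightarrow> prob_space (M i)" and "I \<noteq> {}"
  shows "prob_space.indep_vars (PiM I M) M (\<lambda>i \<omega>. \<omega> i) I"
proof -
  interpret prob_space "PiM I M" by (rule prob_space_PiM[OF prob])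
  have "distr (PiM I M) (PiM I M) (\<lambda>x. \<lambda>i\<in>I. x i) = distr (PiM I M) (PiM I M) (\<lambda>x. x)"
    by (rule distr_cong) (auto simp: space_PiM)
  also have "\<dots> = PiM I M" by (rule distr_id)
  also have "\<dots> = PiM I (\<lambda>i. distr (PiM I M) (M i) (\<lambda>\<omega>. \<omega> i))"
    by (rule PiM_cong) (auto simp: distr_PiM_component prob)
  finally show ?thesis
    by (subst indep_vars_iff_distr_eq_PiM'[OF \<open>I \<noteq> {}\<close>]) auto
qed

text \<open>Discretises the split of \<open>x\<close> between two nonnegative quantities: an integer
  level for the first loses at most 1 in the second, so finitely many splits suffice.\<close>

lemma split_threshold:
  fixes u v x :: real
  assumes "0 \<le> u" "0 \<le> v" "0 \<le> x" "x \<le> u + v"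
  obtains l where "l \<le> nat \<lfloor>x\<rfloor>" "real l \<le> u" "x - real l - 1 \<le> v"
proof (cases "u \<le> x")
  case True
  show ?thesis
  proof (rule that[of "nat \<lfloor>u\<rfloor>"])
    show "nat \<lfloor>u\<rfloor> \<le> nat \<lfloor>x\<rfloor>" using True by (intro nat_mono floor_mono)
    show "real (nat \<lfloor>u\<rfloor>) \<le> u" using assms by simp
    show "x - real (nat \<lfloor>u\<rfloor>) - 1 \<le> v" using assms by simp linarith
  qed
next
  case False
  show ?thesis
  proof (rule that[of "nat \<lfloor>x\<rfloor>"])
    show "real (nat \<lfloor>x\<rfloor>) \<le> u" using assms False by simp linarith
    show "x - real (nat \<lfloor>x\<rfloor>) - 1 \<le> v" using assms by simp linarith
  qed simp
qed

section \<open>Sample space and deviations of a single arm\<close>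

locale bandit = exp_family \<rho> \<Theta> for \<rho> \<Theta> +
  fixes n :: nat and \<nu> :: "nat \<Rightarrow> real"
  assumes params: "i < n \<Longrightarrow> \<nu> i \<in> \<Theta>" and n_pos: "0 < n"
begin

definition P :: "(nat \<times> nat \<Rightarrow> real) measure" where
  "P = PiM ({..<n} \<times> UNIV) (\<lambda>ik. fam \<rho> (\<nu> (fst ik)))"

definition arm_sum :: "nat \<Rightarrow> nat \<Rightarrow> (nat \<times> nat \<Rightarrow> real) \<Rightarrow> real" where
  "arm_sum i a \<omega> = (\<Sum>k<a. \<omega> (i, k))"

text \<open>Compares \<open>\<theta>\<close> with the true parameter \<open>\<nu> i\<close>; the
  data enter only through the sum \<open>s\<close> of \<open>a\<close> samples. The value at
  \<open>\<theta> = \<nu> i\<close> is 0.\<close>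

definition log_lr :: "nat \<Rightarrow> nat \<Rightarrow> real \<Rightarrow> real \<Rightarrow> real" where
  "log_lr i a \<theta> s = (\<theta> - \<nu> i) * s - real a * (B \<theta> - B (\<nu> i))"

lemma prob_space_arm: "ik \<in> {..<n} \<times> UNIV \<Longrightarrow> prob_space (fam \<rho> (\<nu> (fst ik)))"
  by (rule prob_space_fam, rule params) auto

sublocale prob_space P
  unfolding P_def by (rule prob_space_PiM[OF prob_space_arm])

lemma indep_samples: "indep_vars (\<lambda>ik. fam \<rho> (\<nu> (fst ik))) (\<lambda>ik \<omega>. \<omega> ik) ({..<n} \<times> UNIV)"
  unfolding P_def by (rule indep_vars_PiM_components[OF prob_space_arm]) (use n_pos in auto)

lemma measurable_sample: "i < n \<Longrightarrow> (\<lambda>\<omega>. \<omega> (i, k)) \<in> borel_measurable P"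
  using measurable_component_singleton[of "(i, k)" "{..<n} \<times> UNIV" "\<lambda>ik. fam \<rho> (\<nu> (fst ik))"]
  unfolding P_def by (simp cong: measurable_cong_sets)

lemma measurable_arm_sum: "i < n \<Longrightarrow> arm_sum i a \<in> borel_measurable P"
  unfolding arm_sum_def by (intro borel_measurable_sum measurable_sample)

lemma linear_mgf:
  assumes J: "finite J" "J \<subseteq> {..<n} \<times> UNIV"
    and h: "\<And>x. x \<in> J \<Longrightarrow> \<nu> (fst x) + h x \<in> \<Theta>"
  shows "integrable P (\<lambda>\<omega>. exp (\<Sum>x\<in>J. h x * \<omega> x))"
    and "expectation (\<lambda>\<omega>. exp (\<Sum>x\<in>J. h x * \<omega> x)) = exp (\<Sum>x\<in>J. B (\<nu> (fst x) + h x) - B (\<nu> (fst x)))"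
proof -
  have "indep_vars (\<lambda>x. fam \<rho> (\<nu> (fst x))) (\<lambda>x \<omega>. \<omega> x) J"
    using indep_vars_subset[OF indep_samples J(2)] .
  hence ind: "indep_vars (\<lambda>_. borel) (\<lambda>x \<omega>. exp (h x * \<omega> x)) J"
    by (rule indep_vars_compose2[where Y = "\<lambda>x y. exp (h x * y)"])
      (subst measurable_cong_sets[OF sets_fam refl], measurable)
  have one: "integrable P (\<lambda>\<omega>. exp (h x * \<omega> x)) \<and>
      expectation (\<lambda>\<omega>. exp (h x * \<omega> x)) = exp (B (\<nu> (fst x) + h x) - B (\<nu> (fst x)))" if x: "x \<in> J" for x
  proof -
    let ?F = "fam \<rho> (\<nu> (fst x))"
    have xI: "x \<in> {..<n} \<times> UNIV" using x J by auto
    have D: "distr P ?F (\<lambda>\<omega>. \<omega> x) = ?F"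
      unfolding P_def using distr_PiM_component[of "{..<n} \<times> UNIV" "\<lambda>ik. fam \<rho> (\<nu> (fst ik))", OF prob_space_arm xI] .
    have m: "(\<lambda>\<omega>. \<omega> x) \<in> measurable P ?F"
      unfolding P_def using measurable_component_singleton[OF xI] .
    have "\<nu> (fst x) \<in> \<Theta>" using xI params by auto
    note mgf = fam_mgf[OF this h[OF x]]
    have "integrable (distr P ?F (\<lambda>\<omega>. \<omega> x)) (\<lambda>y. exp (h x * y))"
      using mgf(1) by (simp only: D)
    hence "integrable P (\<lambda>\<omega>. exp (h x * \<omega> x))"
      by (rule integrable_distr[OF m])
    moreover have "expectation (\<lambda>\<omega>. exp (h x * \<omega> x)) = (\<integral>y. exp (h x * y) \<partial>distr P ?F (\<lambda>\<omega>. \<omega> x))"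
      by (rule integral_distr[symmetric, OF m]) simp
    ultimately show ?thesis using mgf(2) by (simp only: D)
  qed
  show "integrable P (\<lambda>\<omega>. exp (\<Sum>x\<in>J. h x * \<omega> x))"
    using indep_vars_integrable[OF J(1) ind] one by (simp add: exp_sum J)
  show "expectation (\<lambda>\<omega>. exp (\<Sum>x\<in>J. h x * \<omega> x)) = exp (\<Sum>x\<in>J. B (\<nu> (fst x) + h x) - B (\<nu> (fst x)))"
    using indep_vars_lebesgue_integral[OF J(1) ind] one by (simp add: exp_sum J)
qed

text \<open>Exponential Markov inequality: weighting sample \<open>x\<close> by \<open>h x\<close>
  shifts its parameter by \<open>h x\<close>, so the exponent is a sum of differences of
  \<open>B\<close>. The weights vary with the sample, which covers one arm as well as two arms
  tilted differently.\<close>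

lemma chernoff_linear:
  assumes J: "finite J" "J \<subseteq> {..<n} \<times> UNIV"
    and h: "\<And>x. x \<in> J \<Longrightarrow> \<nu> (fst x) + h x \<in> \<Theta>"
  shows "prob {\<omega> \<in> space P. s \<le> (\<Sum>x\<in>J. h x * \<omega> x)}
    \<le> exp ((\<Sum>x\<in>J. B (\<nu> (fst x) + h x) - B (\<nu> (fst x))) - s)"
proof -
  note mgf = linear_mgf[OF assms]
  have "prob {\<omega> \<in> space P. exp s \<le> exp (\<Sum>x\<in>J. h x * \<omega> x)}
      \<le> expectation (\<lambda>\<omega>. exp (\<Sum>x\<in>J. h x * \<omega> x)) / exp s"
    by (rule integral_Markov_inequality_measure[where A = "{}"]) (use mgf(1) in auto)
  thus ?thesis by (simp add: mgf(2) exp_diff)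
qed

text \<open>A likelihood ratio has expectation 1 under the true parameter, so the log-partition
  terms cancel in Chernoff's bound.\<close>

lemma prob_log_lr_ge:
  assumes "i < n" "\<theta> \<in> \<Theta>"
  shows "prob {\<omega> \<in> space P. x \<le> log_lr i a \<theta> (arm_sum i a \<omega>)} \<le> exp (- x)"
proof -
  have "prob {\<omega> \<in> space P. x + real a * (B \<theta> - B (\<nu> i)) \<le> (\<Sum>y\<in>Pair i ` {..<a}. (\<theta> - \<nu> i) * \<omega> y)}
      \<le> exp ((\<Sum>y\<in>Pair i ` {..<a}. B (\<nu> (fst y) + (\<theta> - \<nu> i)) - B (\<nu> (fst y))) - (x + real a * (B \<theta> - B (\<nu> i))))"
    by (rule chernoff_linear) (use assms in auto)
  also have "\<dots> = exp (- x)"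
    by (simp add: sum.reindex inj_on_def)
  also have "{\<omega> \<in> space P. x + real a * (B \<theta> - B (\<nu> i)) \<le> (\<Sum>y\<in>Pair i ` {..<a}. (\<theta> - \<nu> i) * \<omega> y)} =
      {\<omega> \<in> space P. x \<le> log_lr i a \<theta> (arm_sum i a \<omega>)}"
    by (simp add: sum.reindex inj_on_def arm_sum_def sum_distrib_left log_lr_def le_diff_eq)
  finally show ?thesis .
qed

definition dev_set :: "nat \<Rightarrow> nat \<Rightarrow> real \<Rightarrow> real set" where
  "dev_set i a x = {s. \<exists>\<theta>\<in>\<Theta>. x \<le> log_lr i a \<theta> s}"

text \<open>For a fixed parameter \<open>\<theta>\<close> the event \<open>x \<le> log_lr i a \<theta> s\<close> is a half-line in \<open>s\<close>, so the union
  over all \<open>\<theta>\<close> on one side of \<open>\<nu> i\<close> is again a half-line and costs nothing beyond Chernoff.\<close>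

lemma dev_set_borel_prob:
  assumes i: "i < n"
  shows "dev_set i a x \<in> sets borel" (is ?A)
    and "prob {\<omega> \<in> space P. arm_sum i a \<omega> \<in> dev_set i a x} \<le> 2 * exp (- x)" (is ?B)
proof -
  have "?A \<and> ?B"
  proof (cases "x \<le> 0")
    case True
    \<comment> \<open>The true parameter has ratio 0, so every \<open>s\<close> qualifies; the
      claimed bound is then at least 1.\<close>
    have "dev_set i a x = UNIV"
      unfolding dev_set_def using True params[OF i] by (force simp: log_lr_def)
    moreover have "prob {\<omega> \<in> space P. arm_sum i a \<omega> \<in> UNIV} \<le> 2 * exp (- x)"
      using True by (intro order_trans[OF prob_le_1]) (simp add: order_trans[of 1 "2 * 1"])
    ultimately show ?thesis by simp
  next
    case False
    \<comment> \<open>End point of the half-line belonging to \<open>\<theta>\<close>, read in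
      \<open>s\<close> to the right of \<open>\<nu> i\<close> and in \<open>- s\<close> to the left.
      The point \<open>\<nu> i\<close> itself contributes nothing since \<open>x\<close> is now
      positive.\<close>
    define T where "T \<theta> = (x + real a * (B \<theta> - B (\<nu> i))) / \<bar>\<theta> - \<nu> i\<bar>" for \<theta>
    let ?S = "arm_sum i a"
    let ?p = "{y. \<exists>t\<in>T ` (\<Theta> \<inter> {\<nu> i<..}). t \<le> y}" and ?m = "{y. \<exists>t\<in>T ` (\<Theta> \<inter> {..<\<nu> i}). t \<le> y}"
    have pos: "x \<le> log_lr i a \<theta> s \<longleftrightarrow> T \<theta> \<le> s" if "\<nu> i < \<theta>" for \<theta> s
      using that by (simp add: T_def log_lr_def field_simps)
    have neg: "x \<le> log_lr i a \<theta> s \<longleftrightarrow> T \<theta> \<le> - s" if "\<theta> < \<nu> i" for \<theta> s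
      using that by (simp add: T_def log_lr_def field_simps)
    have mp: "?S \<in> borel_measurable P" and mm: "(\<lambda>\<omega>. - ?S \<omega>) \<in> borel_measurable P"
      using measurable_arm_sum[OF i] by simp_all
    have tp: "measure (distr P borel ?S) {t..} \<le> exp (- x)" if "t \<in> T ` (\<Theta> \<inter> {\<nu> i<..})" for t
    proof -
      obtain \<theta> where \<theta>: "\<theta> \<in> \<Theta>" "\<nu> i < \<theta>" "t = T \<theta>" using \<open>t \<in> _\<close> by auto
      have "measure (distr P borel ?S) {t..} = prob {\<omega> \<in> space P. x \<le> log_lr i a \<theta> (?S \<omega>)}"
        by (subst measure_distr[OF mp])
          (auto simp: pos[OF \<theta>(2)] \<theta>(3) intro!: arg_cong[where f = prob])
      thus ?thesis using prob_log_lr_ge[OF i \<theta>(1)] by simp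
    qed
    have p: "?p \<in> sets borel" "measure (distr P borel ?S) ?p \<le> exp (- x)"
      by (rule upward_closure_measure_le[OF finite_measure_distr[OF mp] sets_distr tp exp_ge_zero], assumption)+
    have tm: "measure (distr P borel (\<lambda>\<omega>. - ?S \<omega>)) {t..} \<le> exp (- x)" if "t \<in> T ` (\<Theta> \<inter> {..<\<nu> i})" for t
    proof -
      obtain \<theta> where \<theta>: "\<theta> \<in> \<Theta>" "\<theta> < \<nu> i" "t = T \<theta>" using \<open>t \<in> _\<close> by auto
      have "measure (distr P borel (\<lambda>\<omega>. - ?S \<omega>)) {t..} = prob {\<omega> \<in> space P. x \<le> log_lr i a \<theta> (?S \<omega>)}"
        by (subst measure_distr[OF mm])
          (auto simp: neg[OF \<theta>(2)] \<theta>(3) intro!: arg_cong[where f = prob])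
      thus ?thesis using prob_log_lr_ge[OF i \<theta>(1)] by simp
    qed
    have m: "?m \<in> sets borel" "measure (distr P borel (\<lambda>\<omega>. - ?S \<omega>)) ?m \<le> exp (- x)"
      by (rule upward_closure_measure_le[OF finite_measure_distr[OF mm] sets_distr tm exp_ge_zero], assumption)+
    have split: "dev_set i a x = ?p \<union> uminus -` ?m"
    proof (intro set_eqI iffI)
      fix s assume "s \<in> dev_set i a x"
      then obtain \<theta> where \<theta>: "\<theta> \<in> \<Theta>" "x \<le> log_lr i a \<theta> s" by (auto simp: dev_set_def)
      have "\<theta> \<noteq> \<nu> i" using \<theta>(2) False by (auto simp: log_lr_def)
      thus "s \<in> ?p \<union> uminus -` ?m" using \<theta> pos[of \<theta> s] neg[of \<theta> s] by (cases \<theta> "\<nu> i" rule: linorder_cases) auto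
    next
      fix s assume "s \<in> ?p \<union> uminus -` ?m"
      thus "s \<in> dev_set i a x" unfolding dev_set_def using pos neg by auto metis
    qed
    have um: "uminus -` ?m \<in> sets borel"
      using measurable_sets[OF borel_measurable_uminus[OF measurable_ident_sets[OF refl]], of ?m] m(1) by simp
    have ev: "{\<omega> \<in> space P. ?S \<omega> \<in> dev_set i a x} = (?S -` ?p \<inter> space P) \<union> ((\<lambda>\<omega>. - ?S \<omega>) -` ?m \<inter> space P)"
      unfolding split by auto
    have "prob {\<omega> \<in> space P. ?S \<omega> \<in> dev_set i a x}
        \<le> prob (?S -` ?p \<inter> space P) + prob ((\<lambda>\<omega>. - ?S \<omega>) -` ?m \<inter> space P)"
      unfolding ev using measurable_sets[OF mp p(1)] measurable_sets[OF mm m(1)] by (rule measure_Un_le)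
    also have "\<dots> \<le> exp (- x) + exp (- x)"
      by (rule add_mono[OF ord_eq_le_trans[OF measure_distr[OF mp p(1), symmetric] p(2)]
            ord_eq_le_trans[OF measure_distr[OF mm m(1), symmetric] m(2)]])
    finally have ?B by simp
    moreover have ?A unfolding split using p(1) um by (rule sets.Un)
    ultimately show ?thesis by blast
  qed
  thus ?A ?B by auto
qed

section \<open>Two arms jointly\<close>

lemma indep_arm_sums:
  assumes "i < n" "j < n" "i \<noteq> j"
  shows "indep_var borel (arm_sum i a) borel (arm_sum j b)"
proof -
  let ?M = "\<lambda>ik. fam \<rho> (\<nu> (fst ik))"
  have "indep_var (PiM (Pair i ` {..<a}) ?M) (\<lambda>\<omega>. restrict (\<lambda>x. \<omega> x) (Pair i ` {..<a}))
      (PiM (Pair j ` {..<b}) ?M) (\<lambda>\<omega>. restrict (\<lambda>x. \<omega> x) (Pair j ` {..<b}))"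
    by (rule indep_var_restrict[OF indep_samples]) (use assms in auto)
  moreover have "arm_sum l c \<in> borel_measurable (PiM (Pair l ` {..<c}) ?M)" for l c
    unfolding arm_sum_def
  proof (rule borel_measurable_sum)
    fix k assume "k \<in> {..<c}"
    hence "(\<lambda>f. f (l, k)) \<in> measurable (PiM (Pair l ` {..<c}) ?M) (?M (l, k))"
      by (intro measurable_component_singleton) auto
    thus "(\<lambda>f. f (l, k)) \<in> borel_measurable (PiM (Pair l ` {..<c}) ?M)"
      by (simp cong: measurable_cong_sets)
  qed
  note m = this
  ultimately have "indep_var borel (arm_sum i a \<circ> (\<lambda>\<omega>. restrict (\<lambda>x. \<omega> x) (Pair i ` {..<a})))
      borel (arm_sum j b \<circ> (\<lambda>\<omega>. restrict (\<lambda>x. \<omega> x) (Pair j ` {..<b})))"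
    by (rule indep_var_compose) (rule m)
  moreover have "arm_sum l c \<circ> (\<lambda>\<omega>. restrict (\<lambda>x. \<omega> x) (Pair l ` {..<c})) = arm_sum l c" for l c
    by (auto simp: fun_eq_iff arm_sum_def intro!: sum.cong)
  ultimately show ?thesis by simp
qed

text \<open>Cover the event by integer splits of \<open>x\<close>. By independence each split has
  probability at most \<open>4 * exp 1 * exp (- x)\<close>, and there are at most
  \<open>x + 1\<close> of them. A measurable superset is supplied because the event is a union over
  uncountably many parameter pairs.\<close>

lemma prob_two_arm_deviation:
  assumes ij: "i < n" "j < n" "i \<noteq> j" and x: "0 \<le> x"
  obtains E where "E \<in> events"
    and "{\<omega> \<in> space P. \<exists>\<theta>\<in>\<Theta>. \<exists>\<theta>'\<in>\<Theta>. x \<le> log_lr i a \<theta> (arm_sum i a \<omega>) + log_lr j b \<theta>' (arm_sum j b \<omega>)} \<subseteq> E"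
    and "prob E \<le> 4 * exp 1 * (x + 1) * exp (- x)"
proof
  let ?S = "arm_sum i a" and ?S' = "arm_sum j b"
  define D where "D l = (\<lambda>\<omega>. (?S \<omega>, ?S' \<omega>)) -` (dev_set i a (real l) \<times> dev_set j b (x - real l - 1)) \<inter> space P" for l :: nat
  define E where "E = (\<Union>l\<le>nat \<lfloor>x\<rfloor>. D l)"
  have Dev: "D l \<in> events" for l
  proof -
    have "D l = (?S -` dev_set i a (real l) \<inter> space P) \<inter> (?S' -` dev_set j b (x - real l - 1) \<inter> space P)"
      by (auto simp: D_def)
    thus ?thesis
      using measurable_sets[OF measurable_arm_sum[OF ij(1)] dev_set_borel_prob(1)[OF ij(1)]]
        measurable_sets[OF measurable_arm_sum[OF ij(2)] dev_set_borel_prob(1)[OF ij(2)]]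
      by auto
  qed
  thus "E \<in> events" by (auto simp: E_def)
  have Dprob: "prob (D l) \<le> 4 * exp 1 * exp (- x)" for l
  proof -
    have "prob (D l) = prob (?S -` dev_set i a (real l) \<inter> space P) * prob (?S' -` dev_set j b (x - real l - 1) \<inter> space P)"
      unfolding D_def using dev_set_borel_prob(1) ij by (intro indep_varD[OF indep_arm_sums]) auto
    also have "\<dots> \<le> (2 * exp (- real l)) * (2 * exp (- (x - real l - 1)))"
      using dev_set_borel_prob(2)[OF ij(1), of a "real l"] dev_set_borel_prob(2)[OF ij(2), of b "x - real l - 1"]
      by (intro mult_mono) (auto simp: vimage_def Int_def conj_commute)
    also have "\<dots> = 4 * exp 1 * exp (- x)"
      by (simp add: exp_add[symmetric])
    finally show ?thesis .
  qed
  have "prob E \<le> (\<Sum>l\<le>nat \<lfloor>x\<rfloor>. prob (D l))"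
    unfolding E_def using Dev by (intro finite_measure_subadditive_finite) auto
  also have "\<dots> \<le> (\<Sum>l\<le>nat \<lfloor>x\<rfloor>. 4 * exp 1 * exp (- x))"
    by (intro sum_mono Dprob)
  also have "\<dots> = (1 + real (nat \<lfloor>x\<rfloor>)) * (4 * exp 1 * exp (- x))" by simp
  also have "\<dots> \<le> (1 + x) * (4 * exp 1 * exp (- x))"
    using x by (intro mult_right_mono) auto
  finally show "prob E \<le> 4 * exp 1 * (x + 1) * exp (- x)" by (simp only: mult_ac add_ac)
  show "{\<omega> \<in> space P. \<exists>\<theta>\<in>\<Theta>. \<exists>\<theta>'\<in>\<Theta>. x \<le> log_lr i a \<theta> (?S \<omega>) + log_lr j b \<theta>' (?S' \<omega>)} \<subseteq> E"
  proof safe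
    fix \<omega> \<theta> \<theta>' assume \<omega>: "\<omega> \<in> space P" and \<theta>: "\<theta> \<in> \<Theta>" "\<theta>' \<in> \<Theta>"
      and le: "x \<le> log_lr i a \<theta> (?S \<omega>) + log_lr j b \<theta>' (?S' \<omega>)"
    \<comment> \<open>A negative ratio may be replaced by 0, the value at the true parameter, so
      both levels are still reached within \<Theta>.\<close>
    define u where "u = max 0 (log_lr i a \<theta> (?S \<omega>))"
    define v where "v = max 0 (log_lr j b \<theta>' (?S' \<omega>))"
    have "0 \<le> u" "0 \<le> v" "x \<le> u + v" using le by (auto simp: u_def v_def)
    then obtain l where l: "l \<le> nat \<lfloor>x\<rfloor>" "real l \<le> u" "x - real l - 1 \<le> v"
      using split_threshold x by metis
    have "?S \<omega> \<in> dev_set i a u" "?S' \<omega> \<in> dev_set j b v"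
      using params ij \<theta> unfolding dev_set_def u_def v_def
      by (auto simp: max_def log_lr_def[where \<theta> = "\<nu> _"] intro: bexI[of _ "\<nu> i"] bexI[of _ "\<nu> j"])
    hence "?S \<omega> \<in> dev_set i a (real l)" "?S' \<omega> \<in> dev_set j b (x - real l - 1)"
      using l unfolding dev_set_def by (blast intro: order_trans)+
    thus "\<omega> \<in> E" using l(1) \<omega> by (auto simp: E_def D_def)
  qed
qed

text \<open>Tilt both arms to the midpoint \<open>r\<close>. The tilts are opposite, so the
  statistic is a positive multiple of the difference of the sums, and each pair of samples
  contributes minus the Jensen gap to the exponent.\<close>

lemma prob_equal_counts_misordered:
  assumes ij: "i < n" "j < n" "i \<noteq> j" and lt: "\<nu> j < \<nu> i"
  shows "prob {\<omega> \<in> space P. arm_sum i a \<omega> \<le> arm_sum j a \<omega>} \<le> exp (- (real a * jensen_gap (\<nu> j) (\<nu> i)))"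
proof -
  define r where "r = (\<nu> j + \<nu> i) / 2"
  define h where "h x = (if fst x = i then r - \<nu> i else r - \<nu> j)" for x :: "nat \<times> nat"
  let ?I = "Pair i ` {..<a}" and ?J = "Pair j ` {..<a}"
  have r: "r \<in> \<Theta>" unfolding r_def using midpoint_mem params ij by simp
  have disj: "sum f (?I \<union> ?J) = (\<Sum>k<a. f (i, k)) + (\<Sum>k<a. f (j, k))" for f :: "nat \<times> nat \<Rightarrow> real"
    using ij by (subst sum.union_disjoint) (auto simp: sum.reindex inj_on_def)
  have "prob {\<omega> \<in> space P. 0 \<le> (\<Sum>x\<in>?I \<union> ?J. h x * \<omega> x)}
      \<le> exp ((\<Sum>x\<in>?I \<union> ?J. B (\<nu> (fst x) + h x) - B (\<nu> (fst x))) - 0)"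
    by (rule chernoff_linear) (use ij r in \<open>auto simp: h_def\<close>)
  also have "(\<Sum>x\<in>?I \<union> ?J. B (\<nu> (fst x) + h x) - B (\<nu> (fst x))) - 0 = - (real a * jensen_gap (\<nu> j) (\<nu> i))"
    using ij unfolding jensen_gap_def r_def[symmetric] by (simp add: disj h_def algebra_simps)
  also have "{\<omega> \<in> space P. 0 \<le> (\<Sum>x\<in>?I \<union> ?J. h x * \<omega> x)} = {\<omega> \<in> space P. arm_sum i a \<omega> \<le> arm_sum j a \<omega>}"
  proof -
    have "(\<Sum>x\<in>?I \<union> ?J. h x * \<omega> x) = (\<nu> i - \<nu> j) / 2 * (arm_sum j a \<omega> - arm_sum i a \<omega>)" for \<omega>
    proof -
      have "(\<Sum>x\<in>?I \<union> ?J. h x * \<omega> x) = (r - \<nu> i) * arm_sum i a \<omega> + (r - \<nu> j) * arm_sum j a \<omega>"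
        using ij by (simp add: disj h_def arm_sum_def sum_distrib_left)
      thus ?thesis by (simp add: r_def field_simps)
    qed
    hence "0 \<le> (\<Sum>x\<in>?I \<union> ?J. h x * \<omega> x) \<longleftrightarrow> arm_sum i a \<omega> \<le> arm_sum j a \<omega>" for \<omega>
      using lt by (simp only: zero_le_mult_iff) auto
    thus ?thesis by simp
  qed
  finally show ?thesis .
qed

end

section \<open>Errors of the algorithm\<close>

lemma best_arm_max:
  assumes "0 < n"
  shows "best_arm n m < n" and "j < n \<Longrightarrow> m j \<le> m (best_arm n m)"
proof -
  have "\<exists>i<n. \<forall>j<n. m j \<le> m i"
    using obtains_MAX[of "{..<n}" m] assms by (metis finite_lessThan lessThan_iff lessThan_empty_iff Max_ge finite_imageI imageI not_gr_zero)
  hence "best_arm n m < n \<and> (\<forall>j<n. m j \<le> m (best_arm n m))"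
    unfolding best_arm_def by (rule LeastI_ex)
  thus "best_arm n m < n" "j < n \<Longrightarrow> m j \<le> m (best_arm n m)" by auto
qed

text \<open>Extracts what the analysis uses of a Stage II step: counts grow by truncated differences
  of ceilings and targets are capped by \<open>L2\<close>.\<close>

lemma stage2_step_shape:
  "\<exists>T w' ex'. stage2_step d M n \<delta> \<epsilon> L2 \<alpha> X (N, w, Tm, ex) =
     (\<lambda>i. N i + nat (\<lceil>T i\<rceil> - \<lceil>Tm i\<rceil>), w', \<lambda>i. max (Tm i) (T i), ex') \<and> (\<forall>i. T i \<le> L2)"
  unfolding stage2_step_def Let_def prod.case by (intro exI conjI, rule refl) auto

text \<open>The increments telescope to the ceiling of the running maximum of the targets. The upper
  bound is \<open>max L1 L2\<close> because the run starts at \<open>L1\<close>, which may exceed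
  \<open>L2\<close>.\<close>

lemma stage2_counts:
  assumes "0 \<le> L1"
    and "(stage2_guarded d M n \<delta> \<epsilon> L2 \<alpha> X ^^ q) (\<lambda>i. nat \<lceil>L1\<rceil>, w, \<lambda>i. L1, False) = (N, w', Tm, ex)"
  shows "N i = nat \<lceil>Tm i\<rceil> \<and> L1 \<le> Tm i \<and> Tm i \<le> max L1 L2"
  using assms(2)
proof (induction q arbitrary: N w' Tm ex)
  case (Suc q)
  obtain N0 w0 T0 ex0 where prev:
    "(stage2_guarded d M n \<delta> \<epsilon> L2 \<alpha> X ^^ q) (\<lambda>i. nat \<lceil>L1\<rceil>, w, \<lambda>i. L1, False) = (N0, w0, T0, ex0)"
    by (metis prod_cases4)
  note IH = Suc.IH[OF prev]
  have eq: "stage2_guarded d M n \<delta> \<epsilon> L2 \<alpha> X (N0, w0, T0, ex0) = (N, w', Tm, ex)"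
    using Suc.prems prev by simp
  show ?case
  proof (cases ex0)
    case True
    thus ?thesis using eq IH by (simp add: stage2_guarded_def)
  next
    case False
    obtain T where T: "N = (\<lambda>i. N0 i + nat (\<lceil>T i\<rceil> - \<lceil>T0 i\<rceil>))" "Tm = (\<lambda>i. max (T0 i) (T i))" "\<And>i. T i \<le> L2"
      using stage2_step_shape[of d M n \<delta> \<epsilon> L2 \<alpha> X N0 w0 T0 ex0] eq False
      by (auto simp: stage2_guarded_def)
    \<comment> \<open>Nonnegativity of the old ceiling is what lets the natural-number sum become a
      maximum of ceilings.\<close>
    have "0 \<le> \<lceil>T0 i\<rceil>" using IH assms(1) by linarith
    hence "nat \<lceil>T0 i\<rceil> + nat (\<lceil>T i\<rceil> - \<lceil>T0 i\<rceil>) = nat (max \<lceil>T0 i\<rceil> \<lceil>T i\<rceil>)" by linarith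
    moreover have "\<lceil>max (T0 i) (T i)\<rceil> = max \<lceil>T0 i\<rceil> \<lceil>T i\<rceil>"
      by (simp add: max_def ceiling_mono) (meson ceiling_mono antisym nle_le)
    ultimately show ?thesis using IH T(3)[of i] by (auto simp: T(1,2))
  qed
qed simp

section \<open>Wrong stopping, likelihood ratios and asymptotic estimates\<close>

context exp_family
begin

text \<open>The left-hand side is the log-likelihood ratio against the common mean \<open>m\<close>. Against the true
  parameters \<open>s \<le> t\<close> the ratio gains at least \<open>a d(m, \<cdot>) + b d(m, \<cdot>)\<close>, and testing both divergences
  with the midpoint parameter bounds their sum below by the Jensen gap, whatever \<open>m\<close> is. Empirical means
  outside the mean set contribute \<open>0\<close> to the statistic, which is matched by choosing the parameter of \<open>m\<close>.\<close>

lemma misordered_Z_le_log_lr: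
  fixes a b y z :: real
  defines "m \<equiv> (a * y + b * z) / (a + b)"
  assumes ab: "0 < a" "0 < b" and yz: "z \<le> y" and st: "s \<in> \<Theta>" "t \<in> \<Theta>" "s \<le> t"
    and Z: "0 < a * fam_div \<rho> \<Theta> y m + b * fam_div \<rho> \<Theta> z m"
  shows "\<exists>\<theta>\<in>\<Theta>. \<exists>\<theta>'\<in>\<Theta>. a * fam_div \<rho> \<Theta> y m + b * fam_div \<rho> \<Theta> z m + min a b * jensen_gap s t
    \<le> a * ((\<theta> - s) * y - (B \<theta> - B s)) + b * ((\<theta>' - t) * z - (B \<theta>' - B t))"
proof -
  \<comment> \<open>Outside the mean set both divergences would take the default value 0, against
    \<open>Z\<close>.\<close>
  have m: "m \<in> mean_set \<rho> \<Theta>"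
    using Z by (rule contrapos_pp) (simp add: fam_div_def)
  define r where "r = nat_param \<rho> \<Theta> m"
  have r: "r \<in> \<Theta>" "fam_mean \<rho> r = m"
    using m by (simp_all add: r_def nat_param_mem fam_mean_nat_param)
  have div: "\<exists>\<theta>\<in>\<Theta>. fam_div \<rho> \<Theta> v m = (\<theta> - r) * v - B \<theta> + B r" for v
  proof (cases "v \<in> mean_set \<rho> \<Theta>")
    case True
    thus ?thesis using m by (intro bexI[of _ "nat_param \<rho> \<Theta> v"]) (simp_all add: fam_div_eq r_def nat_param_mem)
  next
    case False
    thus ?thesis using r by (intro bexI[of _ r]) (simp_all add: fam_div_def)
  qed
  obtain \<theta> \<theta>' where \<theta>: "\<theta> \<in> \<Theta>" "fam_div \<rho> \<Theta> y m = (\<theta> - r) * y - B \<theta> + B r"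
    and \<theta>': "\<theta>' \<in> \<Theta>" "fam_div \<rho> \<Theta> z m = (\<theta>' - r) * z - B \<theta>' + B r"
    using div[of y] div[of z] by auto
  \<comment> \<open>For \<open>v\<close> in \<Theta> this is the divergence from the member at
    \<open>r\<close> to the member at \<open>v\<close>.\<close>
  define K where "K v = (r - v) * m - B r + B v" for v
  define p where "p = (s + t) / 2"
  have K: "0 \<le> K s" "0 \<le> K t"
    using logpart_above_tangent[OF r(1) st(1)] logpart_above_tangent[OF r(1) st(2)] r(2)
    by (simp_all add: K_def algebra_simps)
  have "B r + m * (p - r) \<le> B p"
    using logpart_above_tangent[OF r(1)] midpoint_mem[OF st(1,2)] r(2) by (simp add: p_def)
  hence gap: "jensen_gap s t \<le> K s + K t"
    by (simp add: jensen_gap_def K_def p_def field_simps)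
  \<comment> \<open>As \<open>m\<close> is the weighted mean, \<open>y\<close> exceeds it by the
    same weighted amount as \<open>z\<close> falls short. Passing from \<open>m\<close> to the
    individual means therefore adds \<open>D * (t - s)\<close>, which is nonnegative because the
    order of the means is wrong.\<close>
  define D where "D = a * (y - m)"
  have Dz: "D = b * (m - z)" and D: "D = a * b * (y - z) / (a + b)"
    using ab by (simp_all add: D_def m_def field_simps)
  have "0 \<le> D" unfolding D using ab yz by simp
  have "min a b * jensen_gap s t \<le> min a b * (K s + K t)"
    using ab gap by (intro mult_left_mono) auto
  also have "\<dots> \<le> a * K s + b * K t"
    using K by (simp add: distrib_left add_mono mult_right_mono)
  also have "\<dots> \<le> a * K s + b * K t + D * (t - s)" using \<open>0 \<le> D\<close> st by simp
  also have "\<dots> = a * K s + (r - s) * D + (b * K t - (r - t) * D)" by (simp add: algebra_simps)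
  also have "a * K s + (r - s) * D = a * ((r - s) * y - B r + B s)"
    by (simp add: K_def D_def algebra_simps)
  also have "b * K t - (r - t) * D = b * ((r - t) * z - B r + B t)"
    by (simp add: K_def Dz algebra_simps)
  finally have "a * fam_div \<rho> \<Theta> y m + b * fam_div \<rho> \<Theta> z m + min a b * jensen_gap s t
      \<le> a * ((\<theta> - s) * y - (B \<theta> - B s)) + b * ((\<theta>' - t) * z - (B \<theta>' - B t))"
    by (simp add: \<theta>(2) \<theta>'(2) algebra_simps)
  thus ?thesis using \<theta>(1) \<theta>'(1) by blast
qed

end

context bandit
begin

lemma stage3_error:
  assumes k: "k < n" and lt: "\<nu> k < \<nu> 0"
    and N: "0 < N k" "0 < N 0"
    and le: "emp_mean X N 0 \<le> emp_mean X N k"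
    and Z: "0 < Zstat (fam_div \<rho> \<Theta>) X N k 0"
  shows "\<exists>\<theta>\<in>\<Theta>. \<exists>\<theta>'\<in>\<Theta>. Zstat (fam_div \<rho> \<Theta>) X N k 0 + min (real (N k)) (real (N 0)) * jensen_gap (\<nu> k) (\<nu> 0)
    \<le> log_lr k (N k) \<theta> (arm_sum k (N k) X) + log_lr 0 (N 0) \<theta>' (arm_sum 0 (N 0) X)"
proof -
  have lr: "log_lr i (N i) \<theta> (arm_sum i (N i) X) = real (N i) * ((\<theta> - \<nu> i) * emp_mean X N i - (B \<theta> - B (\<nu> i)))"
    if "0 < N i" for i \<theta>
    using that by (simp add: log_lr_def arm_sum_def emp_mean_def right_diff_distrib)
  show ?thesis
    unfolding lr[OF N(1)] lr[OF N(2)]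
    using misordered_Z_le_log_lr[where a = "real (N k)" and b = "real (N 0)" and y = "emp_mean X N k"
        and z = "emp_mean X N 0" and s = "\<nu> k" and t = "\<nu> 0"]
      N le Z lt params[OF k] params[OF n_pos]
    by (simp add: Zstat_def Let_def)
qed

end

text \<open>Both \<open>ln (1 / (\<delta> / 2))\<close> and \<open>\<tau> powr \<alpha>\<close> are
  at least 1, so the outer logarithm is taken at \<open>2 / \<delta>\<close> or more. This crude
  bound suffices since the Jensen gain pays for the union over pull counts.\<close>

lemma threshold_ge:
  fixes \<delta> \<tau> \<alpha> :: real
  assumes "0 < \<delta>" "1 \<le> ln (1 / \<delta>)" "1 \<le> \<tau>" "0 \<le> \<alpha>"
  shows "ln (1 / \<delta>) \<le> ln (ln (1 / (\<delta> / 2)) * \<tau> powr \<alpha> / (\<delta> / 2))"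
proof -
  have "1 \<le> ln (1 / (\<delta> / 2))"
    using assms by (intro order_trans[OF assms(2)]) (simp add: field_simps)
  moreover have "1 \<le> \<tau> powr \<alpha>" using assms by (simp add: ge_one_powr_ge_zero)
  ultimately have "1 * 1 \<le> ln (1 / (\<delta> / 2)) * \<tau> powr \<alpha>" by (intro mult_mono) auto
  hence "1 / (\<delta> / 2) \<le> ln (1 / (\<delta> / 2)) * \<tau> powr \<alpha> / (\<delta> / 2)"
    using assms by (intro divide_right_mono) auto
  hence "1 / \<delta> \<le> ln (1 / (\<delta> / 2)) * \<tau> powr \<alpha> / (\<delta> / 2)"
    using assms by (auto intro: order_trans[rotated] simp: field_simps)
  thus ?thesis using assms by (subst ln_le_cancel_iff) (auto intro: less_le_trans[of _ "1 / \<delta>"])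
qed

text \<open>The demands on \<delta>, in terms of L = log (1/\<delta>): Stage II counts stay below
  the Stage IV level, and the Stage III and Stage IV errors each take at most half of \<delta> = exp
  (- L). In the Stage III term the factor \<delta> is already divided out.\<close>

lemma eventually_error_budget:
  fixes c :: real and n :: nat
  assumes "0 < c" "0 < n"
  shows "\<forall>\<^sub>F L in at_top. 1 \<le> L \<and> sqrt L \<le> L\<^sup>2 \<and> L * ln L / real n \<le> L\<^sup>2 \<and>
    real n * ((L\<^sup>2 + 2)\<^sup>2 * (4 * exp 1 * (L + c * sqrt L + 1) * exp (- (c * sqrt L)))) \<le> 1 / 2 \<and>
    real n * exp (- (L\<^sup>2 * c)) \<le> exp (- L) / 2"
proof -
  define C where "C = real n"
  have C: "0 < C" using assms by (simp add: C_def)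
  have "((\<lambda>L. C * ((L\<^sup>2 + 2)\<^sup>2 * (4 * exp 1 * (L + c * sqrt L + 1) * exp (- (c * sqrt L))))) \<longlongrightarrow> 0) at_top"
    using assms(1) C by real_asymp
  hence "\<forall>\<^sub>F L in at_top. C * ((L\<^sup>2 + 2)\<^sup>2 * (4 * exp 1 * (L + c * sqrt L + 1) * exp (- (c * sqrt L)))) < 1 / 2"
    by (rule order_tendstoD) simp
  moreover have "\<forall>\<^sub>F L in at_top. C * exp (- (L\<^sup>2 * c)) \<le> exp (- L) / 2"
    using assms(1) C by real_asymp
  moreover have "\<forall>\<^sub>F L :: real in at_top. sqrt L \<le> L\<^sup>2" by real_asymp
  moreover have "\<forall>\<^sub>F L :: real in at_top. L * ln L / C \<le> L\<^sup>2" using C by real_asymp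
  moreover have "\<forall>\<^sub>F L :: real in at_top. 1 \<le> L" by (rule eventually_ge_at_top)
  ultimately show ?thesis unfolding C_def[symmetric] by eventually_elim simp
qed

section \<open>Union bound over arms and pull counts\<close>

theorem mainTheorem2:
  fixes \<rho> :: "real measure" and \<Theta> :: "real set" and n :: nat
    and \<mu> :: "nat \<Rightarrow> real" and \<alpha> :: real
  assumes "sets \<rho> = sets borel"
    and "open \<Theta>" and "is_interval \<Theta>" and "\<Theta> \<noteq> {}"
    and "\<forall>\<theta>\<in>\<Theta>. integrable \<rho> (\<lambda>x. exp (x * \<theta>))"
    and "inj_on (fam_mean \<rho>) \<Theta>"
    and "2 \<le> n"
    and "\<forall>i<n. \<mu> i \<in> mean_set \<rho> \<Theta>"
    and "\<mu> 1 < \<mu> 0"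
    and "\<forall>i. 1 \<le> i \<longrightarrow> Suc i < n \<longrightarrow> \<mu> (Suc i) \<le> \<mu> i"
    and "1 < \<alpha>" and "\<alpha> \<le> exp 1 / 2"
  shows "\<exists>\<delta>0. 0 < \<delta>0 \<and> \<delta>0 < 1 \<and>
    (\<forall>\<delta>. 0 < \<delta> \<and> \<delta> < \<delta>0 \<longrightarrow>
      (let P = PiM ({..<n} \<times> UNIV) (\<lambda>ik. fam \<rho> (nat_param \<rho> \<Theta> (\<mu> (fst ik))));
           out = triBBAI (fam_div \<rho> \<Theta>) (mean_set \<rho> \<Theta>) n \<delta>
                   (1 / ln (ln (1 / \<delta>)))
                   (sqrt (ln (1 / \<delta>)))
                   (ln (1 / \<delta>) * ln (ln (1 / \<delta>)) / real n)
                   ((ln (1 / \<delta>))\<^sup>2)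
                   \<alpha>
                   (\<lambda>t d. ln (ln (1 / d) * t powr \<alpha> / d))
       in \<exists>E\<in>sets P. {\<omega> \<in> space P. out \<omega> \<noteq> 0} \<subseteq> E \<and> measure P E \<le> \<delta>))"
proof -
  define \<nu> where "\<nu> i = nat_param \<rho> \<Theta> (\<mu> i)" for i
  interpret exp_family \<rho> \<Theta>
    by unfold_locales (use assms in auto)
  interpret bandit \<rho> \<Theta> n \<nu>
    by unfold_locales (use assms in \<open>auto simp: \<nu>_def nat_param_mem\<close>)
  let ?K = "{1..<n}"
  have \<mu>_less: "\<mu> k < \<mu> 0" if "k \<in> ?K" for k
  proof -
    have "1 \<le> k \<Longrightarrow> k < n \<Longrightarrow> \<mu> k \<le> \<mu> 1"
    proof (induction k rule: dec_induct)
      case (step l)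
      thus ?case using assms(10) by (metis Suc_lessD order_trans)
    qed simp
    thus ?thesis using that assms(9) by simp
  qed
  have \<nu>_less: "\<nu> k < \<nu> 0" if "k \<in> ?K" for k
    unfolding \<nu>_def using \<mu>_less[OF that] assms(8) that by (intro nat_param_mono) auto
  \<comment> \<open>Uniform over the finitely many suboptimal arms and independent of \<delta>, so
    it may enter the choice of \<open>L0\<close>.\<close>
  define c where "c = Min ((\<lambda>k. jensen_gap (\<nu> k) (\<nu> 0)) ` ?K)"
  have K: "finite ?K" "?K \<noteq> {}" using assms(7) by auto
  have gap: "0 < jensen_gap (\<nu> k) (\<nu> 0)" "c \<le> jensen_gap (\<nu> k) (\<nu> 0)" if "k \<in> ?K" for k
  proof -
    show "0 < jensen_gap (\<nu> k) (\<nu> 0)"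
      using \<nu>_less[OF that] params that n_pos by (intro jensen_gap_pos) auto
    show "c \<le> jensen_gap (\<nu> k) (\<nu> 0)" unfolding c_def using that by (intro Min_le) auto
  qed
  have c: "0 < c" unfolding c_def using K gap(1) by (subst Min_gr_iff) auto
  from eventually_error_budget[OF c n_pos]
  obtain L0 where budget: "\<And>L. L0 \<le> L \<Longrightarrow> 1 \<le> L \<and> sqrt L \<le> L\<^sup>2 \<and> L * ln L / real n \<le> L\<^sup>2 \<and>
      real n * ((L\<^sup>2 + 2)\<^sup>2 * (4 * exp 1 * (L + c * sqrt L + 1) * exp (- (c * sqrt L)))) \<le> 1 / 2 \<and>
      real n * exp (- (L\<^sup>2 * c)) \<le> exp (- L) / 2"
    unfolding eventually_at_top_linorder by blast
  have bound: "\<exists>E\<in>events. {\<omega> \<in> space P. triBBAI (fam_div \<rho> \<Theta>) (mean_set \<rho> \<Theta>) n \<delta> \<epsilon> (sqrt (ln (1 / \<delta>)))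
        (ln (1 / \<delta>) * ln (ln (1 / \<delta>)) / real n) ((ln (1 / \<delta>))\<^sup>2) \<alpha>
        (\<lambda>t d. ln (ln (1 / d) * t powr \<alpha> / d)) \<omega> \<noteq> 0} \<subseteq> E \<and> prob E \<le> \<delta>"
    if \<delta>: "0 < \<delta>" "\<delta> < min (1 / 2) (exp (- L0))" for \<delta> \<epsilon>
  proof -
    define L where "L = ln (1 / \<delta>)"
    have "L0 \<le> L"
    proof -
      have "ln \<delta> \<le> - L0" using \<delta> by (metis less_imp_le ln_exp ln_le_cancel_iff exp_gt_zero min_less_iff_conj)
      thus ?thesis using \<delta> by (simp add: L_def ln_div)
    qed
    note bud = budget[OF this]
    have L: "1 \<le> L" "sqrt L \<le> L\<^sup>2" "L * ln L / real n \<le> L\<^sup>2" using bud by auto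
    have exp_L: "exp (- L) = \<delta>" using \<delta> by (simp add: L_def ln_div)
    define U where "U = nat \<lceil>L\<^sup>2\<rceil>"
    have U: "L\<^sup>2 \<le> real U" "real U \<le> L\<^sup>2 + 1" "0 < U"
    proof -
      have "real U = of_int \<lceil>L\<^sup>2\<rceil>" by (simp add: U_def)
      thus "L\<^sup>2 \<le> real U" "real U \<le> L\<^sup>2 + 1" by linarith+
      moreover have "1 \<le> L\<^sup>2" using L(1) by simp
      ultimately have "1 \<le> real U" by linarith
      thus "0 < U" by simp
    qed
    \<comment> \<open>The threshold contributes at least \<open>L\<close>; the Jensen gain, with at
      least \<open>sqrt L\<close> pulls per arm, contributes \<open>c * sqrt L\<close>.\<close>
    define x where "x = L + c * sqrt L"
    have x: "0 \<le> x" using L c by (simp add: x_def)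
    define dev where "dev k a b = {\<omega> \<in> space P. \<exists>\<theta>\<in>\<Theta>. \<exists>\<theta>'\<in>\<Theta>.
        x \<le> log_lr k a \<theta> (arm_sum k a \<omega>) + log_lr 0 b \<theta>' (arm_sum 0 b \<omega>)}" for k a b
    define p where "p = 4 * exp 1 * (x + 1) * exp (- x)"
    define E3 where "E3 k a b = (SOME E. E \<in> events \<and> dev k a b \<subseteq> E \<and> prob E \<le> p)" for k a b
    have E3: "E3 k a b \<in> events" "dev k a b \<subseteq> E3 k a b" "prob (E3 k a b) \<le> p" if "k \<in> ?K" for k a b
    proof -
      have k: "k < n" "0 < n" "k \<noteq> 0" using that by auto
      obtain E where "E \<in> events" "dev k a b \<subseteq> E" "prob E \<le> p"
        unfolding dev_def p_def by (rule prob_two_arm_deviation[OF k x])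
      hence "\<exists>E. E \<in> events \<and> dev k a b \<subseteq> E \<and> prob E \<le> p" by blast
      from someI_ex[OF this] show "E3 k a b \<in> events" "dev k a b \<subseteq> E3 k a b" "prob (E3 k a b) \<le> p"
        unfolding E3_def by auto
    qed
    \<comment> \<open>The counts at stopping depend on the samples, so all pairs up to the cap
      \<open>U\<close> are included.\<close>
    define F3 where "F3 k = (\<Union>(a, b)\<in>{..U} \<times> {..U}. E3 k a b)" for k
    define F4 where "F4 k = {\<omega> \<in> space P. arm_sum 0 U \<omega> \<le> arm_sum k U \<omega>}" for k
    define E where "E = (\<Union>k\<in>?K. F3 k \<union> F4 k)"
    have F3: "F3 k \<in> events" "prob (F3 k) \<le> (L\<^sup>2 + 2)\<^sup>2 * p" if k: "k \<in> ?K" for k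
    proof -
      show "F3 k \<in> events" unfolding F3_def using E3(1)[OF k] by (intro sets.finite_UN) auto
      have "prob (F3 k) \<le> (\<Sum>(a, b)\<in>{..U} \<times> {..U}. prob (E3 k a b))"
        unfolding F3_def using E3(1)[OF k]
        by (intro order_trans[OF finite_measure_subadditive_finite]) (auto simp: case_prod_beta)
      also have "\<dots> \<le> (\<Sum>(a, b)\<in>{..U} \<times> {..U}. p)"
        using E3(3)[OF k] by (intro sum_mono) auto
      \<comment> \<open>The range includes 0, and rounding makes \<open>U\<close> at most
        \<open>L\<^sup>2 + 1\<close>; hence \<open>L\<^sup>2 + 2\<close> below.\<close>
      also have "\<dots> = (real U + 1)\<^sup>2 * p" by (simp add: power2_eq_square algebra_simps)
      also have "\<dots> \<le> (L\<^sup>2 + 2)\<^sup>2 * p"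
        using U x by (intro mult_right_mono power_mono) (auto simp: p_def)
      finally show "prob (F3 k) \<le> (L\<^sup>2 + 2)\<^sup>2 * p" .
    qed
    have F4: "F4 k \<in> events" "prob (F4 k) \<le> exp (- (L\<^sup>2 * c))" if k: "k \<in> ?K" for k
    proof -
      have kn: "k < n" "k \<noteq> 0" using k by auto
      show "F4 k \<in> events" unfolding F4_def
        using measurable_arm_sum[OF n_pos] measurable_arm_sum[OF kn(1)] by measurable
      have "prob (F4 k) \<le> exp (- (real U * jensen_gap (\<nu> k) (\<nu> 0)))"
        unfolding F4_def using kn n_pos \<nu>_less[OF k] by (intro prob_equal_counts_misordered) auto
      also have "\<dots> \<le> exp (- (L\<^sup>2 * c))"
        using U(1) gap[OF k] c by (auto intro!: mult_mono)
      finally show "prob (F4 k) \<le> exp (- (L\<^sup>2 * c))" .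
    qed
    have "prob E \<le> (\<Sum>k\<in>?K. prob (F3 k \<union> F4 k))"
      unfolding E_def using F3(1) F4(1) K by (intro finite_measure_subadditive_finite) auto
    also have "\<dots> \<le> (\<Sum>k\<in>?K. (L\<^sup>2 + 2)\<^sup>2 * p + exp (- (L\<^sup>2 * c)))"
      using F3 F4 by (intro sum_mono order_trans[OF measure_Un_le] add_mono) auto
    also have "\<dots> = real (n - 1) * ((L\<^sup>2 + 2)\<^sup>2 * p + exp (- (L\<^sup>2 * c)))" by simp
    also have "\<dots> \<le> real n * ((L\<^sup>2 + 2)\<^sup>2 * p + exp (- (L\<^sup>2 * c)))"
      using x by (intro mult_right_mono) (auto simp: p_def)
    also have "\<dots> \<le> \<delta>"
    proof -
      have "exp (- x) = \<delta> * exp (- (c * sqrt L))"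
        by (simp add: x_def exp_L[symmetric] exp_add[symmetric])
      hence "p = \<delta> * (4 * exp 1 * (L + c * sqrt L + 1) * exp (- (c * sqrt L)))"
        unfolding p_def by (simp add: x_def)
      hence "real n * ((L\<^sup>2 + 2)\<^sup>2 * p) =
          \<delta> * (real n * ((L\<^sup>2 + 2)\<^sup>2 * (4 * exp 1 * (L + c * sqrt L + 1) * exp (- (c * sqrt L)))))"
        by (simp only: mult_ac)
      also have "\<dots> \<le> \<delta> * (1 / 2)" using bud \<delta> by (intro mult_left_mono) auto
      finally have "real n * ((L\<^sup>2 + 2)\<^sup>2 * p) \<le> \<delta> / 2" by simp
      moreover have "real n * exp (- (L\<^sup>2 * c)) \<le> \<delta> / 2" using bud exp_L by auto
      ultimately show ?thesis by (simp add: distrib_left)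
    qed
    finally have prob_E: "prob E \<le> \<delta>" .
    have "\<omega> \<in> E" if \<omega>: "\<omega> \<in> space P"
      and err: "triBBAI (fam_div \<rho> \<Theta>) (mean_set \<rho> \<Theta>) n \<delta> \<epsilon> (sqrt L) (L * ln L / real n) (L\<^sup>2) \<alpha>
        (\<lambda>t d. ln (ln (1 / d) * t powr \<alpha> / d)) \<omega> \<noteq> 0" for \<omega>
    proof -
      obtain N w Tm ex where run:
        "(stage2_guarded (fam_div \<rho> \<Theta>) (mean_set \<rho> \<Theta>) n \<delta> \<epsilon> (L * ln L / real n) \<alpha> \<omega> ^^ nat \<lceil>ln (1 / \<delta>)\<rceil>)
          (\<lambda>i. nat \<lceil>sqrt L\<rceil>, uniform_w n, \<lambda>i. sqrt L, False) = (N, w, Tm, ex)"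
        by (metis prod_cases4)
      have counts: "N i = nat \<lceil>Tm i\<rceil> \<and> sqrt L \<le> Tm i \<and> Tm i \<le> max (sqrt L) (L * ln L / real n)" for i
        using stage2_counts[OF _ run] L(1) by simp
      have N_ge: "sqrt L \<le> real (N i)" for i using counts[of i] by linarith
      have N_pos: "0 < N i" for i
      proof -
        have "1 \<le> sqrt L" using L(1) by simp
        thus ?thesis using N_ge[of i] by linarith
      qed
      have N_le: "N i \<le> U" for i
      proof -
        have "Tm i \<le> L\<^sup>2" using counts[of i] L(2,3) by linarith
        thus ?thesis using counts[of i] unfolding U_def by (metis nat_mono ceiling_mono)
      qed
      define Z where "Z = Zstat (fam_div \<rho> \<Theta>) \<omega> N"
      define k where "k = best_arm n (emp_mean \<omega> N)"
      define k' where "k' = best_arm n (emp_mean \<omega> (\<lambda>i. U))"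
      \<comment> \<open>Stage IV thus ends with the same deterministic count on every arm, so
        comparing means is comparing sums at the single count \<open>U\<close>.\<close>
      have max_U: "max (N i) U = U" for i using N_le[of i] by simp
      have out: "(if \<forall>j<n. j \<noteq> k \<longrightarrow> ln (ln (1 / (\<delta> / 2)) * real (\<Sum>i<n. N i) powr \<alpha> / (\<delta> / 2)) \<le> Z k j
          then k else k') \<noteq> 0"
        using err unfolding triBBAI_def Let_def run fst_conv k_def k'_def Z_def U_def[symmetric] max_U .
      show ?thesis
      proof (cases "\<forall>j<n. j \<noteq> k \<longrightarrow> ln (ln (1 / (\<delta> / 2)) * real (\<Sum>i<n. N i) powr \<alpha> / (\<delta> / 2)) \<le> Z k j")
        case True
        hence "k \<noteq> 0" using out by simp
        hence k: "k \<in> ?K" using best_arm_max(1)[OF n_pos] by (auto simp: k_def)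
        have "N 0 \<le> (\<Sum>i<n. N i)" using n_pos by (intro member_le_sum) auto
        hence "1 \<le> real (\<Sum>i<n. N i)" using N_pos[of 0] by linarith
        hence "L \<le> ln (ln (1 / (\<delta> / 2)) * real (\<Sum>i<n. N i) powr \<alpha> / (\<delta> / 2))"
          unfolding L_def using \<delta> L(1) assms(11) by (intro threshold_ge) (auto simp: L_def)
        also have "\<dots> \<le> Z k 0" using True \<open>k \<noteq> 0\<close> n_pos by auto
        finally have Z: "L \<le> Z k 0" .
        have "sqrt L * c \<le> min (real (N k)) (real (N 0)) * jensen_gap (\<nu> k) (\<nu> 0)"
          using N_ge[of k] N_ge[of 0] gap[OF k] c by (intro mult_mono) auto
        hence "x \<le> Z k 0 + min (real (N k)) (real (N 0)) * jensen_gap (\<nu> k) (\<nu> 0)"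
          using Z by (simp add: x_def mult.commute)
        moreover have "\<exists>\<theta>\<in>\<Theta>. \<exists>\<theta>'\<in>\<Theta>. Z k 0 + min (real (N k)) (real (N 0)) * jensen_gap (\<nu> k) (\<nu> 0)
            \<le> log_lr k (N k) \<theta> (arm_sum k (N k) \<omega>) + log_lr 0 (N 0) \<theta>' (arm_sum 0 (N 0) \<omega>)"
          unfolding Z_def
        proof (rule stage3_error)
          show "emp_mean \<omega> N 0 \<le> emp_mean \<omega> N k" unfolding k_def by (rule best_arm_max(2)[OF n_pos n_pos])
          show "0 < Zstat (fam_div \<rho> \<Theta>) \<omega> N k 0" using Z L(1) unfolding Z_def by linarith
        qed (use k \<nu>_less[OF k] N_pos in auto)
        ultimately have "\<omega> \<in> dev k (N k) (N 0)"
          unfolding dev_def using \<omega> by (blast intro: order_trans)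
        hence "\<omega> \<in> F3 k" unfolding F3_def using E3(2)[OF k] N_le by blast
        thus ?thesis using k unfolding E_def by blast
      next
        case False
        have "k' \<noteq> 0" using out unfolding if_not_P[OF False] .
        hence k': "k' \<in> ?K" using best_arm_max(1)[OF n_pos] by (auto simp: k'_def)
        have "emp_mean \<omega> (\<lambda>i. U) 0 \<le> emp_mean \<omega> (\<lambda>i. U) k'"
          unfolding k'_def by (rule best_arm_max(2)[OF n_pos n_pos])
        hence "arm_sum 0 U \<omega> \<le> arm_sum k' U \<omega>"
          using U(3) by (simp add: emp_mean_def arm_sum_def divide_le_cancel)
        thus ?thesis using k' \<omega> unfolding E_def F4_def by blast
      qed
    qed
    moreover have "E \<in> events" unfolding E_def using F3(1) F4(1) K by (intro sets.finite_UN) auto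
    ultimately show ?thesis using prob_E unfolding L_def by blast
  qed
  show ?thesis
  proof (intro exI conjI allI impI)
    \<comment> \<open>\<open>exp (- L0)\<close> enforces \<open>L0 \<le> L\<close>, and 1/2 keeps
      \<delta>0 below 1.\<close>
    show "0 < min (1 / 2) (exp (- L0))" by simp
    show "min (1 / 2) (exp (- L0)) < 1" by linarith
  next
    fix \<delta> :: real assume "0 < \<delta> \<and> \<delta> < min (1 / 2) (exp (- L0))"
    thus "let P = PiM ({..<n} \<times> UNIV) (\<lambda>ik. fam \<rho> (nat_param \<rho> \<Theta> (\<mu> (fst ik))));
           out = triBBAI (fam_div \<rho> \<Theta>) (mean_set \<rho> \<Theta>) n \<delta>
                   (1 / ln (ln (1 / \<delta>))) (sqrt (ln (1 / \<delta>)))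
                   (ln (1 / \<delta>) * ln (ln (1 / \<delta>)) / real n) ((ln (1 / \<delta>))\<^sup>2) \<alpha>
                   (\<lambda>t d. ln (ln (1 / d) * t powr \<alpha> / d))
       in \<exists>E\<in>sets P. {\<omega> \<in> space P. out \<omega> \<noteq> 0} \<subseteq> E \<and> measure P E \<le> \<delta>"
      using bound[of \<delta> "1 / ln (ln (1 / \<delta>))"] unfolding Let_def P_def \<nu>_def by blast
  qed
qed

end
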